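(* Let $b,k,C$ be positive integer constants. There is a constant $A$ depending only on $b,k,C$ such that the following holds. Let $P$ be a set of $m$ points in the plane $\mathbb{R}^2$, and let $\Gamma$ be a family of $n$ distinct planar curves such that (i) every $\gamma\in\Gamma$ is an algebraic curve of degree at most $b$, and (ii) for every $k$ distinct points in the plane, there exist at most $C$ distinct curves in $\Gamma$ passing through all of them. Then $$I(P,\Gamma)\le A\left(m^{k/(2k-1)}\,n^{(2k-2)/(2k-1)}+m+n\right).$$
   Context: A planar algebraic curve of degree at most $b$ is the zero set $Z(g)=\{(x,y)\in\mathbb{R}^2 : g(x,y)=0\}$ of a nonconstant real bivariate polynomial $g\in\mathbb{R}[x,y]$ of (total) degree at most $b$. $I(P,\Gamma)$ denotes the number of incidences, i.e., pairs $(p,\gamma)$ with $p\in P$, $\gamma\in\Gamma$, and $p\in\gamma$. The numbers $m$ and $n$ are positive integers. *)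

theory Defs
  imports "HOL-Analysis.Analysis" "HOL-Computational_Algebra.Polynomial"
begin

text \<open>
  A polynomial in $\mathbb{R}[x,y]$ is an element of $\mathbb{R}[x][y]$, i.e.\ of type
  \<open>real poly poly\<close>: the coefficient of $x^i y^j$ in \<open>g\<close> is \<open>coeff (coeff g j) i\<close>.
\<close>

definition eval2 :: "real poly poly \<Rightarrow> real \<Rightarrow> real \<Rightarrow> real" where
  "eval2 g x y = poly (poly g [:y:]) x"

text \<open>The zero polynomial gets total degree 0.\<close>

definition total_degree :: "real poly poly \<Rightarrow> nat" where
  "total_degree g = Max (insert 0 {i + j | i j. coeff (coeff g j) i \<noteq> 0})"

lemma total_degree_le_iff:
  "total_degree g \<le> b \<longleftrightarrow> (\<forall>i j. coeff (coeff g j) i \<noteq> 0 \<longrightarrow> i + j \<le> b)"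
proof -
  have "{i + j | i j. coeff (coeff g j) i \<noteq> 0}
      \<subseteq> (\<Union>j\<le>degree g. (\<lambda>i. i + j) ` {..degree (coeff g j)})"
    by (force intro: le_degree)
  then have "finite {i + j | i j. coeff (coeff g j) i \<noteq> 0}"
    by (rule finite_subset) auto
  then show ?thesis
    unfolding total_degree_def by auto
qed

lemma eval2_eq_sum:
  "eval2 g x y = (\<Sum>j\<le>degree g. \<Sum>i\<le>degree (coeff g j). coeff (coeff g j) i * x ^ i * y ^ j)"
  by (simp add: eval2_def poly_altdef[of g] poly_sum poly_altdef[of "coeff g _"]
      sum_distrib_right)

definition zero_set :: "real poly poly \<Rightarrow> (real \<times> real) set" where
  "zero_set g = {(x, y). eval2 g x y = 0}"

definition algebraic_curve :: "nat \<Rightarrow> (real \<times> real) set \<Rightarrow> bool" where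
  "algebraic_curve b \<gamma> \<longleftrightarrow>
     (\<exists>g. (\<nexists>c. g = [:[:c:]:]) \<and> total_degree g \<le> b \<and> \<gamma> = zero_set g)"

definition incidences :: "(real \<times> real) set \<Rightarrow> (real \<times> real) set set \<Rightarrow> nat" where
  "incidences P \<Gamma> = card {(p, \<gamma>). p \<in> P \<and> \<gamma> \<in> \<Gamma> \<and> p \<in> \<gamma>}"

end

theory Submission
  imports Defs "HOL-Computational_Algebra.Field_as_Ring" "Subresultants.Subresultant_Gcd"
begin

text \<open>
The curves are cut into boundedly many \<open>x\<close>-monotone arcs, and the incidences of arcs are
bounded by random sampling in the manner of Clarkson and Shor.

\<^bold>\<open>Arcs.\<close> Let \<open>N\<close> arcs be given, any two of which cross boundedly often, and any \<open>k\<close> points of which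
lie on boundedly many. Choose a random set \<open>R\<close> of \<open>r\<close> arcs and decompose the complement of their
union into the cells of the vertical decomposition. Inside a cell that contains \<open>m'\<close> of the points and
is met by \<open>n'\<close> of the arcs, double counting the \<open>k\<close>-subsets of the points on each arc gives
\<open>O(n' + m' n'\<^sup>1\<^sup>-\<^sup>1\<^sup>/\<^sup>k)\<close> incidences (\<open>incidences_in_cell_le\<close>). Two facts about random \<open>R\<close> turn this into a
global bound. An arc meets \<open>O(r)\<close> cells on average, because it changes cell only where it meets an arc of
\<open>R\<close> or passes directly above or below a vertex of the arrangement of \<open>R\<close>, and among \<open>r + 1\<close> arcs at most one
is directly below a given vertex of the others (\<open>sum_card_events\<close>, \<open>card_cells_met_le\<close>). The cell
of a fixed point is met by \<open>O(N/r)\<close> arcs on average, because such an arc \<open>s\<close> is one of at most four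
arcs of \<open>R \<union> {s}\<close> that shape the cell of the point there (\<open>card_conflicts_le\<close>). Together they
give \<open>O(N r + m (N/r)\<^sup>1\<^sup>-\<^sup>1\<^sup>/\<^sup>k)\<close> incidences (\<open>incidences_sampling_bound\<close>), and the two summands are
balanced by \<open>r = m\<^sup>\<alpha> N\<^sup>-\<^sup>\<beta>\<close> with \<open>\<alpha> = k/(2k-1)\<close> and \<open>\<beta> = 1/(2k-1)\<close> (\<open>incidences_bound\<close>).

No faces of a planar map appear: a cell is the class of an equivalence relation \<open>joined R\<close> on points,
given by the arcs directly above and below them, and the only topology is the connectedness of intervals.

\<^bold>\<open>Curves.\<close> Different curves may share components, so the curves are replaced by the zero sets of the
prime factors of their polynomials. A prime factor with fewer than \<open>k\<close> of the points on it is
negligible, and any other one divides at most \<open>C\<close> of the polynomials (\<open>sum_curves_le_sum_primes\<close>).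
A point lies on at most one vertical line. For two distinct primes that are not vertical the resultant is a
nonzero polynomial in \<open>x\<close> of bounded degree that vanishes at every common zero, which bounds the crossings
(\<open>common_zeros_primes\<close>). For one prime \<open>f\<close> the zeros of its leading coefficient and of the resultant of
\<open>f\<close> and its \<open>y\<close>-derivative are the critical values; between two of them the number of real \<open>y\<close> with \<open>f(x, y) = 0\<close> is
constant and the \<open>i\<close>-th root is a continuous function of \<open>x\<close> (\<open>branch_continuous\<close>). These functions are
the arcs, and the points over critical values are few (\<open>sum_incidences_le_arcs\<close>).
\<close>

section \<open>Arrangements of x-monotone arcs\<close>

text \<open>
An arc \<open>a\<close> is the graph of \<open>h a\<close> over the compact interval from \<open>lo a\<close> to \<open>hi a\<close>. Compactness makes
the ends of an arc points of the plane, so that they can serve as vertices of an arrangement.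
\<close>

locale arc_system =
  fixes A :: "'a set" and lo hi :: "'a \<Rightarrow> real" and h :: "'a \<Rightarrow> real \<Rightarrow> real" and B :: nat
  assumes finite_arcs: "finite A"
    and arc_cont: "a \<in> A \<Longrightarrow> continuous_on {lo a..hi a} (h a)"
    and finite_crossings: "\<lbrakk>a \<in> A; b \<in> A; a \<noteq> b\<rbrakk> \<Longrightarrow>
          finite {x \<in> {lo a..hi a} \<inter> {lo b..hi b}. h a x = h b x}"
    and card_crossings: "\<lbrakk>a \<in> A; b \<in> A; a \<noteq> b\<rbrakk> \<Longrightarrow>
          card {x \<in> {lo a..hi a} \<inter> {lo b..hi b}. h a x = h b x} \<le> B"
begin

definition over :: "'a \<Rightarrow> real \<Rightarrow> bool" where
  "over a x \<longleftrightarrow> lo a \<le> x \<and> x \<le> hi a"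

definition passes :: "'a \<Rightarrow> real \<times> real \<Rightarrow> bool" where
  "passes a p \<longleftrightarrow> over a (fst p) \<and> h a (fst p) = snd p"

definition cross :: "'a \<Rightarrow> 'a \<Rightarrow> real set" where
  "cross a b = {x. over a x \<and> over b x \<and> h a x = h b x}"

text \<open>
The arcs of \<open>R\<close> that the vertical ray upwards from \<open>p\<close> hits first. There are several of them exactly
when the first point that it hits is a crossing.
\<close>

definition up :: "'a set \<Rightarrow> real \<times> real \<Rightarrow> 'a set" where
  "up R p = {a \<in> R. over a (fst p) \<and> snd p < h a (fst p) \<and>
     (\<forall>b\<in>R. over b (fst p) \<and> snd p < h b (fst p) \<longrightarrow> h a (fst p) \<le> h b (fst p))}"

definition down :: "'a set \<Rightarrow> real \<times> real \<Rightarrow> 'a set" where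
  "down R p = {a \<in> R. over a (fst p) \<and> h a (fst p) < snd p \<and>
     (\<forall>b\<in>R. over b (fst p) \<and> h b (fst p) < snd p \<longrightarrow> h b (fst p) \<le> h a (fst p))}"

definition between :: "'a set \<Rightarrow> 'a set \<Rightarrow> 'a \<Rightarrow> real \<Rightarrow> bool" where
  "between U L c x \<longleftrightarrow> over c x \<and> (\<forall>a\<in>U. h c x < h a x) \<and> (\<forall>a\<in>L. h a x < h c x)"

text \<open>
The cells of the vertical decomposition of \<open>R\<close>, as a relation between points: the same arc bounds both
points from above, the same arc bounds them from below, and no arc of \<open>R\<close> enters the strip between
these two arcs on the way from one point to the other. A point that sees a crossing vertically lies on a wall
of the decomposition and is joined to itself only; every other cell is bounded by at most one arc
above and at most one arc below.
\<close>

definition joined :: "'a set \<Rightarrow> real \<times> real \<Rightarrow> real \<times> real \<Rightarrow> bool" where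
  "joined R p q \<longleftrightarrow> p = q \<or>
     (card (up R p) \<le> 1 \<and> card (down R p) \<le> 1 \<and> up R p = up R q \<and> down R p = down R q \<and>
      (\<forall>c\<in>R. \<forall>x\<in>{min (fst p) (fst q)..max (fst p) (fst q)}. \<not> between (up R p) (down R p) c x))"

text \<open>
Reflection in the \<open>x\<close>-axis exchanges \<open>up\<close> and \<open>down\<close> and halves the work below.
\<close>

lemma reflected: "arc_system A lo hi (\<lambda>a x. - h a x) B"
  using finite_arcs arc_cont finite_crossings card_crossings
  by unfold_locales (auto intro: continuous_on_minus)

lemma down_reflected: "arc_system.up lo hi (\<lambda>a x. - h a x) R (x, - y) = down R (x, y)"
  unfolding arc_system.up_def[OF reflected] down_def by simp

lemma joined_refl: "joined R p p"
  by (simp add: joined_def)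

lemma joined_sym: "joined R p q \<Longrightarrow> joined R q p"
  unfolding joined_def by (auto simp: min.commute max.commute)

lemma joined_trans:
  assumes 1: "joined R p q" and 2: "joined R q w"
  shows "joined R p w"
proof (cases "p = q \<or> q = w")
  case False
  have *: "x \<in> {min (fst p) (fst q)..max (fst p) (fst q)} \<or> x \<in> {min (fst q) (fst w)..max (fst q) (fst w)}"
    if "x \<in> {min (fst p) (fst w)..max (fst p) (fst w)}" for x
    using that by (auto simp: min_def max_def split: if_splits)
  have eqs: "card (up R p) \<le> 1" "card (down R p) \<le> 1" "up R q = up R p" "down R q = down R p"
    "up R w = up R p" "down R w = down R p"
    using 1 2 False unfolding joined_def by auto
  have "\<not> between (up R p) (down R p) c x"
    if "c \<in> R" "x \<in> {min (fst p) (fst w)..max (fst p) (fst w)}" for c x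
    using *[OF that(2)] that(1) 1 2 False unfolding joined_def eqs by blast
  then show ?thesis using eqs unfolding joined_def by auto
qed (use 1 2 in auto)

lemma up_remove:
  assumes "s \<notin> up R p"
  shows "up (R - {s}) p = up R p"
proof -
  have "h a (fst p) \<le> h s (fst p)" if "a \<in> up (R - {s}) p" "s \<in> R" "over s (fst p)" "snd p < h s (fst p)" for a
  proof (rule ccontr)
    assume "\<not> ?thesis"
    moreover have "\<forall>b\<in>R - {s}. over b (fst p) \<and> snd p < h b (fst p) \<longrightarrow> h a (fst p) \<le> h b (fst p)"
      using that(1) by (simp add: up_def)
    ultimately have "\<forall>b\<in>R. over b (fst p) \<and> snd p < h b (fst p) \<longrightarrow> h s (fst p) \<le> h b (fst p)"
      by fastforce
    then show False using assms that by (simp add: up_def)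
  qed
  then have "up (R - {s}) p \<subseteq> up R p"
    by (auto simp: up_def)
  moreover have "up R p \<subseteq> up (R - {s}) p"
    using assms by (auto simp: up_def)
  ultimately show ?thesis by auto
qed

lemma down_remove:
  assumes "s \<notin> down R p"
  shows "down (R - {s}) p = down R p"
proof -
  interpret neg: arc_system A lo hi "\<lambda>a x. - h a x" B by (rule reflected)
  show ?thesis
    using neg.up_remove[of s R "(fst p, - snd p)"] assms by (simp add: down_reflected)
qed

lemma up_nonempty:
  assumes "finite R" "c \<in> R" "over c (fst p)" "snd p < h c (fst p)"
  obtains a where "a \<in> up R p" "h a (fst p) \<le> h c (fst p)"
proof -
  let ?S = "{a\<in>R. over a (fst p) \<and> snd p < h a (fst p)}"
  have "finite ?S" "?S \<noteq> {}" using assms by auto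
  then have "Min ((\<lambda>a. h a (fst p)) ` ?S) \<in> (\<lambda>a. h a (fst p)) ` ?S"
    by (intro Min_in) auto
  then obtain a where "a \<in> ?S" "Min ((\<lambda>a. h a (fst p)) ` ?S) = h a (fst p)"
    by auto
  moreover from this have "h a (fst p) \<le> h b (fst p)" if "b \<in> ?S" for b
    using Min_le[of "(\<lambda>a. h a (fst p)) ` ?S" "h b (fst p)"] \<open>finite ?S\<close> that by simp
  ultimately have "a \<in> ?S" "\<forall>b\<in>?S. h a (fst p) \<le> h b (fst p)" by blast+
  then show ?thesis using assms by (intro that[of a]) (auto simp: up_def)
qed

lemma down_nonempty:
  assumes "finite R" "c \<in> R" "over c (fst p)" "h c (fst p) < snd p"
  obtains a where "a \<in> down R p" "h c (fst p) \<le> h a (fst p)"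
proof -
  interpret neg: arc_system A lo hi "\<lambda>a x. - h a x" B by (rule reflected)
  show ?thesis
    using neg.up_nonempty[of R c "(fst p, - snd p)"] assms that
    by (auto simp: down_reflected)
qed

lemma two_of_card:
  assumes "1 < card U"
  obtains a b where "a \<in> U" "b \<in> U" "a \<noteq> b"
proof -
  have "finite U" using assms by (intro card_ge_0_finite) simp
  then show ?thesis using assms card_le_Suc0_iff_eq[of U] that by auto
qed

text \<open>
To average the number of arcs that meet the cell of \<open>p\<close>, the pairs of a sample and a further arc \<open>s\<close>
that meets this cell are counted by their union \<open>R\<close>; these are the \<open>s\<close> that a given \<open>R\<close> accounts for.
\<close>

definition conflicts :: "'a set \<Rightarrow> real \<times> real \<Rightarrow> 'a set" where
  "conflicts R p = {s \<in> R. (\<forall>a\<in>R - {s}. \<not> passes a p) \<and> (\<exists>q. passes s q \<and> joined (R - {s}) p q)}"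

text \<open>
If an arc of \<open>R\<close> passes through \<open>p\<close>, no other arc is in conflict; if \<open>p\<close> sees a crossing
vertically, only the arcs of that crossing can be. In the remaining case an arc in conflict bounds the cell of
\<open>p\<close> from above or from below, or it enters the strip between these two bounds on the left or on the right of
\<open>p\<close>. It is alone in each of these four roles: of two arcs that enter the strip to the left of \<open>p\<close>, the one
that enters it nearer to \<open>p\<close> remains in \<open>R\<close> when the other one is removed, and cuts \<open>p\<close> off from the
place where the other one enters.
\<close>

lemma card_conflicts_le:
  assumes R: "finite R"
  shows "card (conflicts R p) \<le> 4"
proof -
  have two: "card (conflicts R p) \<le> 4" if "conflicts R p \<subseteq> {a, b}" for a b
    using card_mono[OF _ that] card_insert_le_m1[of 2 "{b}" a] by (simp add: card_insert_if split: if_splits)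
  show ?thesis
  proof (cases "\<exists>a\<in>R. passes a p")
    case True
    then obtain a where a: "a \<in> R" "passes a p" by auto
    then have "conflicts R p \<subseteq> {a, a}"
      unfolding conflicts_def by auto
    then show ?thesis by (rule two)
  next
    case False
    then have off: "\<And>a. a \<in> R \<Longrightarrow> \<not> passes a p" by auto
    consider "1 < card (up R p)" | "1 < card (down R p)" |
      "card (up R p) \<le> 1" "card (down R p) \<le> 1" by linarith
    then show ?thesis
    proof cases
      case 1
      then obtain a b where ab: "a \<in> up R p" "b \<in> up R p" "a \<noteq> b"
        by (elim two_of_card) auto
      have "s \<in> {a, b}" if sc: "s \<in> conflicts R p" for s
      proof (rule ccontr)
        assume s: "s \<notin> {a, b}"
        obtain q where q: "passes s q" "joined (R - {s}) p q" "s \<in> R"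
          using sc unfolding conflicts_def by blast
        have "{a, b} \<subseteq> up (R - {s}) p" using ab s unfolding up_def by auto
        then have "card {a,b} \<le> card (up (R - {s}) p)"
          using R by (intro card_mono) (auto simp: up_def)
        then have "p = q" using q(2) ab(3) unfolding joined_def by auto
        then show False using q off by blast
      qed
      then show ?thesis by (intro two) auto
    next
      case 2
      then obtain a b where ab: "a \<in> down R p" "b \<in> down R p" "a \<noteq> b"
        by (elim two_of_card) auto
      have "s \<in> {a, b}" if sc: "s \<in> conflicts R p" for s
      proof (rule ccontr)
        assume s: "s \<notin> {a, b}"
        obtain q where q: "passes s q" "joined (R - {s}) p q" "s \<in> R"
          using sc unfolding conflicts_def by blast
        have "{a, b} \<subseteq> down (R - {s}) p" using ab s unfolding down_def by auto
        then have "card {a,b} \<le> card (down (R - {s}) p)"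
          using R by (intro card_mono) (auto simp: down_def)
        then have "p = q" using q(2) ab(3) unfolding joined_def by auto
        then show False using q off by blast
      qed
      then show ?thesis by (intro two) auto
    next
      case c1: 3
    let ?U = "up R p" and ?L = "down R p"
    define W where "W = conflicts R p - ?U - ?L"
    have "\<forall>s\<in>W. \<exists>q::real\<times>real. between ?U ?L s (fst q) \<and>
        (\<forall>c\<in>R-{s}. \<forall>x\<in>{min (fst p) (fst q)..max (fst p) (fst q)}. \<not> between ?U ?L c x)"
    proof
      fix s assume sW: "s \<in> W"
      then obtain q where q: "passes s q" "joined (R - {s}) p q" "s \<in> R"
        unfolding conflicts_def W_def by blast
      have eq: "up (R - {s}) p = ?U" "down (R - {s}) p = ?L"
        using sW by (auto simp: W_def up_remove down_remove)
      have "p \<noteq> q" using off q by auto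
      then have j: "up (R - {s}) q = ?U" "down (R - {s}) q = ?L"
        "\<forall>c\<in>R-{s}. \<forall>x\<in>{min (fst p) (fst q)..max (fst p) (fst q)}. \<not> between ?U ?L c x"
        using q(2) unfolding joined_def eq by auto
      have bt: "between ?U ?L s (fst q)"
        using q(1) unfolding between_def j(1,2)[symmetric] by (auto simp: passes_def up_def down_def)
      show "\<exists>q::real\<times>real. between ?U ?L s (fst q) \<and>
        (\<forall>c\<in>R-{s}. \<forall>x\<in>{min (fst p) (fst q)..max (fst p) (fst q)}. \<not> between ?U ?L c x)"
        by (rule exI[of _ q], rule conjI[OF bt j(3)])
    qed
    then have "\<exists>f::'a \<Rightarrow> real \<times> real. \<forall>s\<in>W. between ?U ?L s (fst (f s)) \<and>
        (\<forall>c\<in>R-{s}. \<forall>x\<in>{min (fst p) (fst (f s))..max (fst p) (fst (f s))}. \<not> between ?U ?L c x)"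
      by (rule bchoice)
    then obtain f :: "'a \<Rightarrow> real \<times> real" where
      f0: "\<forall>s\<in>W. between ?U ?L s (fst (f s)) \<and>
        (\<forall>c\<in>R-{s}. \<forall>x\<in>{min (fst p) (fst (f s))..max (fst p) (fst (f s))}. \<not> between ?U ?L c x)"
      by (rule exE)
    have f: "between ?U ?L s (fst (f s))" if "s \<in> W" for s
      using bspec[OF f0 that] by (rule conjunct1)
    have f': "\<not> between ?U ?L c x"
      if "s \<in> W" "c \<in> R - {s}" "x \<in> {min (fst p) (fst (f s))..max (fst p) (fst (f s))}" for s c x
      using bspec[OF bspec[OF conjunct2[OF bspec[OF f0 that(1)]] that(2)] that(3)] .
    have WR: "W \<subseteq> R" by (auto simp: W_def conflicts_def)
    \<comment> \<open>Of two arcs with witnesses to the left of \<open>p\<close>, the nearer witness lies on the way to the farther one.\<close>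
    have left: "card {s\<in>W. fst (f s) \<le> fst p} \<le> Suc 0"
    proof (subst card_le_Suc0_iff_eq)
      show "finite {s\<in>W. fst (f s) \<le> fst p}" using finite_subset[OF WR R] by auto
      show "\<forall>a1\<in>{s\<in>W. fst (f s) \<le> fst p}. \<forall>a2\<in>{s\<in>W. fst (f s) \<le> fst p}. a1 = a2"
      proof (intro ballI)
        fix s t assume st: "s \<in> {s\<in>W. fst (f s) \<le> fst p}" "t \<in> {s\<in>W. fst (f s) \<le> fst p}"
        show "s = t"
          using f[of s] f[of t] f'[of s t "fst (f t)"] f'[of t s "fst (f s)"] st WR
          by (cases "fst (f s) \<le> fst (f t)") auto
      qed
    qed
    have right: "card {s\<in>W. fst p < fst (f s)} \<le> Suc 0"
    proof (subst card_le_Suc0_iff_eq)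
      show "finite {s\<in>W. fst p < fst (f s)}" using finite_subset[OF WR R] by auto
      show "\<forall>a1\<in>{s\<in>W. fst p < fst (f s)}. \<forall>a2\<in>{s\<in>W. fst p < fst (f s)}. a1 = a2"
      proof (intro ballI)
        fix s t assume st: "s \<in> {s\<in>W. fst p < fst (f s)}" "t \<in> {s\<in>W. fst p < fst (f s)}"
        show "s = t"
          using f[of s] f[of t] f'[of s t "fst (f t)"] f'[of t s "fst (f s)"] st WR
          by (cases "fst (f s) \<le> fst (f t)") auto
      qed
    qed
    have "card (conflicts R p) \<le> card (?U \<union> ?L \<union> ({s\<in>W. fst (f s) \<le> fst p} \<union> {s\<in>W. fst p < fst (f s)}))"
      using finite_subset[OF WR R] R by (intro card_mono) (auto simp: W_def up_def down_def)
    also have "\<dots> \<le> (card ?U + card ?L) + (card {s\<in>W. fst (f s) \<le> fst p} + card {s\<in>W. fst p < fst (f s)})"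
      by (meson add_mono card_Un_le le_trans)
    finally show ?thesis using c1 left right by linarith
    qed
  qed
qed

text \<open>
Seen from a point with abscissa \<open>x\<close>, the arcs \<open>U\<close> directly above (or below) it show neither a
crossing nor an end of an arc.
\<close>

definition regular :: "'a set \<Rightarrow> real \<Rightarrow> bool" where
  "regular U x \<longleftrightarrow> card U \<le> 1 \<and> (\<forall>a\<in>U. lo a < x \<and> x < hi a)"

definition meets :: "'a set \<Rightarrow> 'a \<Rightarrow> real set" where
  "meets R s = (\<Union>c\<in>R. cross c s)"

definition ceiling_events :: "'a set \<Rightarrow> 'a \<Rightarrow> real set" where
  "ceiling_events R s = {x. over s x \<and> x \<notin> meets R s \<and> \<not> regular (up R (x, h s x)) x}"

definition floor_events :: "'a set \<Rightarrow> 'a \<Rightarrow> real set" where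
  "floor_events R s = {x. over s x \<and> x \<notin> meets R s \<and> \<not> regular (down R (x, h s x)) x}"

text \<open>
The abscissas at which a point that moves along \<open>s\<close> can leave its cell: \<open>s\<close> meets an arc of \<open>R\<close>,
or a vertex of the arrangement of \<open>R\<close> is directly above or directly below the point.
\<close>

definition events :: "'a set \<Rightarrow> 'a \<Rightarrow> real set" where
  "events R s = meets R s \<union> ceiling_events R s \<union> floor_events R s"

lemma eventually_below:
  assumes "c \<in> A" "s \<in> A" "over c x" "h s x < h c x" "{u..v} \<subseteq> {lo s..hi s}" "x \<in> {u..v}"
  shows "eventually (\<lambda>y. over c y \<longrightarrow> h s y < h c y) (at x within {u..v})"
proof -
  let ?S = "{lo c..hi c} \<inter> {u..v}"
  have "continuous_on ?S (\<lambda>y. h c y - h s y)"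
    using assms by (intro continuous_on_diff continuous_on_subset[OF arc_cont]) auto
  then have "((\<lambda>y. h c y - h s y) \<longlongrightarrow> h c x - h s x) (at x within ?S)"
    using assms by (auto simp: continuous_on_def over_def)
  then have "eventually (\<lambda>y. 0 < h c y - h s y) (at x within ?S)"
    by (rule order_tendstoD) (use assms in auto)
  then show ?thesis
    by (auto simp: eventually_at over_def)
qed

lemma eventually_not_over:
  assumes "\<not> over c x"
  shows "eventually (\<lambda>y. \<not> over c y) (at x within S)"
proof -
  have "eventually (\<lambda>y. y \<in> - {lo c..hi c}) (at x within S)"
    using assms by (intro eventually_at_topological[THEN iffD2] exI[of _ "- {lo c..hi c}"])
      (auto simp: over_def)
  then show ?thesis by eventually_elim (auto simp: over_def)
qed

text \<open>
Away from an event no arc of \<open>R\<close> changes its side of \<open>s\<close>, and an arc whose domain misses \<open>x\<close>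
misses a neighbourhood of \<open>x\<close>, since domains are closed. The lowest arc above \<open>s\<close> stays strictly below the
others, and it extends to both sides of \<open>x\<close>.
\<close>

lemma up_locally_constant:
  assumes R: "finite R" "R \<subseteq> A" and s: "s \<in> A" "{u..v} \<subseteq> {lo s..hi s}" and x: "x \<in> {u..v}"
    and ev: "x \<notin> meets R s" "regular (up R (x, h s x)) x"
  shows "eventually (\<lambda>y. up R (x, h s x) = up R (y, h s y)) (at x within {u..v})"
proof -
  let ?T = "up R (x, h s x)" and ?F = "at x within {u..v}"
  have os: "over s x" using s x by (auto simp: over_def)
  have finT: "finite ?T" using R by (auto simp: up_def)
  \<comment> \<open>No arc changes its side of \<open>s\<close>, and none appears from nowhere, since its domain is closed.\<close>
  have side: "eventually (\<lambda>y. \<forall>c\<in>R. over c y \<longrightarrow>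
      over c x \<and> (h s x < h c x \<longrightarrow> h s y < h c y) \<and> (h c x < h s x \<longrightarrow> h c y < h s y)) ?F"
  proof (rule eventually_ball_finite[OF R(1)], intro ballI)
    fix c assume c: "c \<in> R"
    show "eventually (\<lambda>y. over c y \<longrightarrow>
      over c x \<and> (h s x < h c x \<longrightarrow> h s y < h c y) \<and> (h c x < h s x \<longrightarrow> h c y < h s y)) ?F"
    proof (cases "over c x")
      case False
      then show ?thesis using eventually_not_over[OF False] by (auto elim!: eventually_mono)
    next
      case True
      have "h c x \<noteq> h s x" using ev(1) c True os by (auto simp: meets_def cross_def)
      then consider "h s x < h c x" | "h c x < h s x" by linarith
      then show ?thesis
      proof cases
        case 1
        then show ?thesis using eventually_below[of c s x u v] c R s x True
          by (auto elim!: eventually_mono)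
      next
        case 2
        interpret neg: arc_system A lo hi "\<lambda>a x. - h a x" B by (rule reflected)
        show ?thesis using neg.eventually_below[of c s x u v] 2 c R s x True
          by (auto elim!: eventually_mono)
      qed
    qed
  qed
  show ?thesis
  proof (cases "?T = {}")
    case True
    then have none: "\<not> (over c x \<and> h s x < h c x)" if "c \<in> R" for c
      using up_nonempty[of R c "(x, h s x)"] that R by (metis empty_iff fst_conv snd_conv)
    from side show ?thesis
    proof eventually_elim
      case (elim y)
      have "\<not> (over c y \<and> h s y < h c y)" if "c \<in> R" for c
        using elim none[OF that] that ev(1) os
        by (smt (verit, ccfv_SIG) UN_I cross_def mem_Collect_eq meets_def)
      then have "up R (y, h s y) = {}" by (auto simp: up_def)
      then show ?case using True by simp
    qed
  next
    case False
    then obtain a where T: "?T = {a}"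
      using ev(2) card_le_Suc0_iff_eq[OF finT] unfolding regular_def by auto
    have a: "a \<in> R" "over a x" "h s x < h a x" "lo a < x" "x < hi a"
      using ev(2) T unfolding regular_def by (auto simp: up_def)
    have lowest: "h a x < h c x" if "c \<in> R" "c \<noteq> a" "over c x" "h s x < h c x" for c
    proof (rule ccontr)
      assume "\<not> ?thesis"
      moreover have "h a x \<le> h b x" if "b \<in> R" "over b x" "h s x < h b x" for b
        using that T by (auto simp: up_def)
      ultimately have "c \<in> ?T" using that unfolding up_def by force
      then show False using T that by auto
    qed
    have oa: "eventually (\<lambda>y. over a y) ?F"
    proof -
      have "eventually (\<lambda>y. y \<in> {lo a<..<hi a}) ?F"
        using a by (intro eventually_at_topological[THEN iffD2] exI[of _ "{lo a<..<hi a}"]) auto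
      then show ?thesis by eventually_elim (auto simp: over_def)
    qed
    have low: "eventually (\<lambda>y. \<forall>c\<in>R. c \<noteq> a \<longrightarrow> over c x \<longrightarrow> h s x < h c x \<longrightarrow> over c y \<longrightarrow> over a y \<longrightarrow> h a y < h c y) ?F"
    proof (rule eventually_ball_finite[OF R(1)], intro ballI)
      fix c assume c: "c \<in> R"
      show "eventually (\<lambda>y. c \<noteq> a \<longrightarrow> over c x \<longrightarrow> h s x < h c x \<longrightarrow> over c y \<longrightarrow> over a y \<longrightarrow> h a y < h c y) ?F"
      proof (cases "c \<noteq> a \<and> over c x \<and> h s x < h c x")
        case True
        let ?S = "{lo c..hi c} \<inter> {lo a..hi a}"
        have "continuous_on ?S (\<lambda>y. h c y - h a y)"
          using R c a by (intro continuous_on_diff continuous_on_subset[OF arc_cont]) auto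
        then have "((\<lambda>y. h c y - h a y) \<longlongrightarrow> h c x - h a x) (at x within ?S)"
          using a True by (auto simp: continuous_on_def over_def)
        then have "eventually (\<lambda>y. 0 < h c y - h a y) (at x within ?S)"
          by (rule order_tendstoD) (use lowest[of c] c True in auto)
        then show ?thesis
          by (auto simp: eventually_at over_def)
      qed auto
    qed
    from side oa low show ?thesis
    proof eventually_elim
      case (elim y)
      have above: "over c x \<and> h s x < h c x" if "c \<in> R" "over c y" "h s y < h c y" for c
        using elim(1) that ev(1) os
        by (smt (verit, ccfv_SIG) UN_I cross_def mem_Collect_eq meets_def)
      have ay: "h s y < h a y" using elim a by auto
      have "h a y \<le> h c y" if "c \<in> R" "over c y" "h s y < h c y" for c
        using above[OF that] elim that by (cases "c = a") (auto intro: less_imp_le)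
      then have "a \<in> up R (y, h s y)" using a ay elim by (auto simp: up_def)
      moreover have "c = a" if "c \<in> up R (y, h s y)" for c
      proof (rule ccontr)
        assume "c \<noteq> a"
        have c: "c \<in> R" "over c y" "h s y < h c y"
          using that by (simp_all add: up_def)
        have "\<forall>b\<in>R. over b y \<and> h s y < h b y \<longrightarrow> h c y \<le> h b y"
          using that unfolding up_def by simp
        then have "h c y \<le> h a y" using a(1) ay elim(2) by blast
        moreover have "h a y < h c y"
          using elim(2,3) c above[OF c] \<open>c \<noteq> a\<close> by blast
        ultimately show False by simp
      qed
      ultimately have "up R (y, h s y) = {a}" by blast
      then show ?case using T by simp
    qed
  qed
qed

lemma up_constant:
  assumes R: "finite R" "R \<subseteq> A" and s: "s \<in> A" "{u..v} \<subseteq> {lo s..hi s}"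
    and ev: "\<And>x. x \<in> {u..v} \<Longrightarrow> x \<notin> meets R s \<and> regular (up R (x, h s x)) x"
    and xy: "x \<in> {u..v}" "y \<in> {u..v}"
  shows "up R (x, h s x) = up R (y, h s y)"
proof (rule connected_local_const[of "{u..v}" x y "\<lambda>x. up R (x, h s x)"])
  show "\<forall>a\<in>{u..v}. \<forall>\<^sub>F b in at a within {u..v}. up R (a, h s a) = up R (b, h s b)"
    using up_locally_constant[OF R s] ev by blast
qed (use xy in auto)

text \<open>
Connectedness of the interval makes the arcs directly above and below \<open>s\<close> constant on it. Every other
arc of \<open>R\<close> lies, at each abscissa, above the upper one or below the lower one, hence not between them.
\<close>

lemma joined_if_no_event:
  assumes R: "finite R" "R \<subseteq> A" and s: "s \<in> A" "over s u" "over s v" and "u \<le> v"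
    and ev: "{u..v} \<inter> events R s = {}"
  shows "joined R (u, h s u) (v, h s v)"
proof -
  interpret neg: arc_system A lo hi "\<lambda>a x. - h a x" B by (rule reflected)
  have sub: "{u..v} \<subseteq> {lo s..hi s}" using s by (auto simp: over_def)
  have reg: "x \<notin> meets R s \<and> regular (up R (x, h s x)) x \<and> regular (down R (x, h s x)) x"
    if "x \<in> {u..v}" for x
  proof -
    have "over s x" using that s by (auto simp: over_def)
    then show ?thesis using ev that by (auto simp: events_def ceiling_events_def floor_events_def)
  qed
  have U: "up R (x, h s x) = up R (u, h s u)" if "x \<in> {u..v}" for x
    using reg that \<open>u \<le> v\<close> by (intro up_constant[OF R s(1) sub]) auto
  have neg_meets: "neg.meets = meets"
    by (intro ext) (simp add: neg.meets_def meets_def neg.cross_def cross_def)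
  have L: "down R (x, h s x) = down R (u, h s u)" if "x \<in> {u..v}" for x
    using neg.up_constant[OF R s(1) sub, of x u] reg that \<open>u \<le> v\<close>
    by (simp add: down_reflected neg_meets)
  have "\<not> between (up R (u, h s u)) (down R (u, h s u)) c x" if cR: "c \<in> R" and xuv: "x \<in> {u..v}" for c x
  proof
    assume "between (up R (u, h s u)) (down R (u, h s u)) c x"
    then have b: "over c x" "\<And>a. a \<in> up R (x, h s x) \<Longrightarrow> h c x < h a x"
      "\<And>a. a \<in> down R (x, h s x) \<Longrightarrow> h a x < h c x"
      using U[OF xuv] L[OF xuv] by (auto simp: between_def)
    have "over s x" using xuv s by (auto simp: over_def)
    then have "h c x \<noteq> h s x" using reg[OF xuv] cR b by (auto simp: meets_def cross_def)
    then consider "h s x < h c x" | "h c x < h s x" by linarith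
    then show False
    proof cases
      case 1
      then obtain a where "a \<in> up R (x, h s x)" "h a x \<le> h c x"
        using up_nonempty[of R c "(x, h s x)"] R cR b(1) by auto
      then show False using b(2)[of a] by simp
    next
      case 2
      then obtain a where "a \<in> down R (x, h s x)" "h c x \<le> h a x"
        using down_nonempty[of R c "(x, h s x)"] R cR b(1) by auto
      then show False using b(3)[of a] by simp
    qed
  qed
  then show ?thesis
    using U[of v] L[of v] reg[of u] \<open>u \<le> v\<close> unfolding joined_def regular_def by auto
qed


lemma card_cross_le: "a \<in> A \<Longrightarrow> b \<in> A \<Longrightarrow> a \<noteq> b \<Longrightarrow> finite (cross a b) \<and> card (cross a b) \<le> B"
  using finite_crossings[of a b] card_crossings[of a b]
  by (simp add: cross_def over_def conj_ac)

definition vertices :: "'a set \<Rightarrow> (real \<times> real) set" where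
  "vertices R = (\<Union>a\<in>R. {(lo a, h a (lo a)), (hi a, h a (hi a))}) \<union>
     (\<Union>(a, b)\<in>{(a, b). a \<in> R \<and> b \<in> R \<and> a \<noteq> b}. (\<lambda>x. (x, h a x)) ` cross a b)"

lemma vertices_bound:
  assumes "R \<subseteq> A"
  shows "finite (vertices R) \<and> card (vertices R) \<le> 2 * card R + B * (card R)\<^sup>2"
proof -
  have R: "finite R" using assms finite_arcs finite_subset by blast
  let ?D = "{(a, b). a \<in> R \<and> b \<in> R \<and> a \<noteq> b}"
  have D: "finite ?D" "card ?D \<le> card R * card R"
  proof -
    have "?D \<subseteq> R \<times> R" by auto
    then show "finite ?D" "card ?D \<le> card R * card R"
      using R card_mono[of "R \<times> R" ?D] finite_subset[of ?D "R \<times> R"] by (auto simp: card_cartesian_product)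
  qed
  have cr: "finite (cross a b) \<and> card (cross a b) \<le> B" if "(a, b) \<in> ?D" for a b
    using that assms card_cross_le[of a b] by auto
  have 1: "card (\<Union>a\<in>R. {(lo a, h a (lo a)), (hi a, h a (hi a))}) \<le> (\<Sum>a\<in>R. 2)"
    by (rule order_trans[OF card_UN_le[OF R] sum_mono]) (simp add: card_insert_if)
  have 2: "card (\<Union>(a, b)\<in>?D. (\<lambda>x. (x, h a x)) ` cross a b) \<le> (\<Sum>d\<in>?D. B)"
    by (rule order_trans[OF card_UN_le[OF D(1)] sum_mono])
       (use cr in \<open>auto intro: order_trans[OF card_image_le]\<close>)
  have "card (vertices R) \<le> (\<Sum>a\<in>R. 2) + (\<Sum>d\<in>?D. B)"
    unfolding vertices_def using card_Un_le 1 2 by (rule order_trans[OF _ add_mono])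
  also have "\<dots> \<le> 2 * card R + B * (card R)\<^sup>2"
    using D(2) by (simp add: power2_eq_square mult.commute)
  finally show ?thesis
    using R D cr by (auto simp: vertices_def)
qed

lemma up_le: "\<lbrakk>a \<in> up R p; b \<in> R; over b (fst p); snd p < h b (fst p)\<rbrakk> \<Longrightarrow> h a (fst p) \<le> h b (fst p)"
  by (simp add: up_def)

lemma upD: "a \<in> up R p \<Longrightarrow> a \<in> R" "a \<in> up R p \<Longrightarrow> over a (fst p)" "a \<in> up R p \<Longrightarrow> snd p < h a (fst p)"
  by (simp_all add: up_def)

lemma up_same_height: "\<lbrakk>a \<in> up R p; b \<in> up R p\<rbrakk> \<Longrightarrow> h a (fst p) = h b (fst p)"
  by (rule antisym; rule up_le[where R = R]) (simp_all add: upD)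

text \<open>
A ceiling event of \<open>s\<close> is charged to the vertex that causes it. No vertex is charged twice: if \<open>s\<close>
and \<open>t\<close> were both directly below it, the lower one of them would see the other one first.
\<close>

lemma sum_card_ceiling_events:
  assumes "R \<subseteq> A"
  shows "(\<forall>s\<in>R. finite (ceiling_events (R - {s}) s)) \<and>
    (\<Sum>s\<in>R. card (ceiling_events (R - {s}) s)) \<le> card (vertices R)"
proof -
  have R: "finite R" using assms finite_arcs finite_subset by blast
  let ?S = "Sigma R (\<lambda>s. ceiling_events (R - {s}) s)"
  define top where "top = (\<lambda>(s, x). SOME a. a \<in> up (R - {s}) (x, h s x))"
  have top: "top (s, x) \<in> up (R - {s}) (x, h s x)" and vert: "(x, h (top (s, x)) x) \<in> vertices R"
    if "(s, x) \<in> ?S" for s x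
  proof -
    let ?U = "up (R - {s}) (x, h s x)"
    have sx: "s \<in> R" "\<not> regular ?U x" using that by (auto simp: ceiling_events_def)
    then have "?U \<noteq> {}" by (auto simp: regular_def)
    then show t: "top (s, x) \<in> ?U" by (simp add: top_def some_in_eq)
    have tR: "top (s, x) \<in> R" "over (top (s, x)) x" using upD[OF t] by simp_all
    have same: "h a x = h (top (s, x)) x" if "a \<in> ?U" for a
      using up_same_height[OF that t] by simp
    show "(x, h (top (s, x)) x) \<in> vertices R"
    proof (cases "card ?U \<le> 1")
      case True
      then obtain a where a: "a \<in> ?U" "\<not> (lo a < x \<and> x < hi a)"
        using sx by (auto simp: regular_def)
      then have "a \<in> R" "x = lo a \<or> x = hi a" using upD[OF a(1)] by (auto simp: over_def)
      then have "(x, h a x) \<in> vertices R" unfolding vertices_def by blast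
      then show ?thesis using same[OF a(1)] by simp
    next
      case False
      then obtain a b where ab: "a \<in> ?U" "b \<in> ?U" "a \<noteq> b"
        using two_of_card[of ?U] by auto
      then have "x \<in> cross a b" "a \<in> R" "b \<in> R"
        using same[of a] same[of b] upD[OF ab(1)] upD[OF ab(2)] by (auto simp: cross_def)
      then have "(x, h a x) \<in> vertices R" using ab(3) unfolding vertices_def by blast
      then show ?thesis using same[OF ab(1)] by simp
    qed
  qed
  let ?f = "\<lambda>(s, x). (x, h (top (s, x)) x)"
  have lt: "\<not> h s x < h t x" if s: "(s, x) \<in> ?S" and t: "(t, x) \<in> ?S" "h (top (s, x)) x = h (top (t, x)) x"
    for s t x
  proof
    assume less: "h s x < h t x"
    have "t \<in> R - {s}" "over t x" using less t by (auto simp: ceiling_events_def)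
    then have "h (top (s, x)) x \<le> h t x"
      using up_le[OF top[OF s], of t] less by simp
    moreover have "h t x < h (top (t, x)) x" using upD[OF top[OF t(1)]] by simp
    ultimately show False using t by simp
  qed
  have inj: "inj_on ?f ?S"
  proof (rule inj_onI)
    fix p q assume p: "p \<in> ?S" and q: "q \<in> ?S" and pq: "?f p = ?f q"
    obtain s x t y where [simp]: "p = (s, x)" "q = (t, y)" by (cases p, cases q)
    have eqs: "y = x" "h (top (s, x)) x = h (top (t, x)) x" using pq by auto
    have "h s x = h t x" using lt[of s x t] lt[of t x s] p q eqs by force
    moreover have "over s x" "over t x" "x \<notin> meets (R - {s}) s" "t \<in> R"
      using p q eqs by (auto simp: ceiling_events_def)
    ultimately have "s = t" by (auto simp: meets_def cross_def)
    then show "p = q" using eqs by simp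
  qed
  have img: "?f ` ?S \<subseteq> vertices R" using vert by auto
  have fin: "finite ?S"
    using finite_imageD[OF finite_subset[OF img] inj] vertices_bound[OF assms] by blast
  have fin': "finite (ceiling_events (R - {s}) s)" if "s \<in> R" for s
    by (rule finite_subset[OF _ finite_imageI[OF fin, of snd]]) (use that in force)
  have "(\<Sum>s\<in>R. card (ceiling_events (R - {s}) s)) = card ?S"
    using R fin' by simp
  also have "\<dots> \<le> card (vertices R)"
    using card_inj_on_le[OF inj img] vertices_bound[OF assms] by blast
  finally show ?thesis using fin' by auto
qed

lemma sum_card_floor_events:
  assumes "R \<subseteq> A"
  shows "(\<forall>s\<in>R. finite (floor_events (R - {s}) s)) \<and>
    (\<Sum>s\<in>R. card (floor_events (R - {s}) s)) \<le> 2 * card R + B * (card R)\<^sup>2"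
proof -
  interpret neg: arc_system A lo hi "\<lambda>a x. - h a x" B by (rule reflected)
  have neg_meets: "neg.meets = meets"
    by (intro ext) (simp add: neg.meets_def meets_def neg.cross_def cross_def)
  have "neg.ceiling_events = floor_events"
    by (intro ext) (simp add: neg.ceiling_events_def floor_events_def neg_meets down_reflected)
  then show ?thesis
    using neg.sum_card_ceiling_events[OF assms] neg.vertices_bound[OF assms] by (auto intro: order_trans)
qed

lemma meets_bound:
  assumes "R \<subseteq> A" "s \<in> A" "s \<notin> R"
  shows "finite (meets R s) \<and> card (meets R s) \<le> B * card R"
proof -
  have R: "finite R" using assms finite_arcs finite_subset by blast
  have c: "finite (cross c s) \<and> card (cross c s) \<le> B" if "c \<in> R" for c
    using that assms by (intro card_cross_le) auto
  have "card (meets R s) \<le> (\<Sum>c\<in>R. B)" unfolding meets_def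
    by (rule order_trans[OF card_UN_le[OF R] sum_mono]) (use c in auto)
  then show ?thesis using R c by (auto simp: meets_def mult.commute)
qed

lemma sum_card_events:
  assumes "R \<subseteq> A"
  shows "(\<forall>s\<in>R. finite (events (R - {s}) s)) \<and>
    (\<Sum>s\<in>R. card (events (R - {s}) s)) \<le> 4 * card R + 3 * B * (card R)\<^sup>2"
proof -
  have R: "finite R" using assms finite_arcs finite_subset by blast
  have m: "finite (meets (R - {s}) s) \<and> card (meets (R - {s}) s) \<le> B * card R" if "s \<in> R" for s
  proof -
    have "card (R - {s}) \<le> card R" using R by (intro card_mono) auto
    then have "B * card (R - {s}) \<le> B * card R" by simp
    moreover have "finite (meets (R - {s}) s) \<and> card (meets (R - {s}) s) \<le> B * card (R - {s})"
      using that assms by (intro meets_bound) auto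
    ultimately show ?thesis by linarith
  qed
  have "(\<Sum>s\<in>R. card (events (R - {s}) s)) \<le>
    (\<Sum>s\<in>R. card (meets (R - {s}) s) + card (ceiling_events (R - {s}) s) + card (floor_events (R - {s}) s))"
    unfolding events_def by (intro sum_mono order_trans[OF card_Un_le] add_mono card_Un_le order_refl)
  also have "\<dots> = (\<Sum>s\<in>R. card (meets (R - {s}) s)) + (\<Sum>s\<in>R. card (ceiling_events (R - {s}) s))
      + (\<Sum>s\<in>R. card (floor_events (R - {s}) s))"
    by (simp add: sum.distrib)
  also have "\<dots> \<le> card R * (B * card R) + (2 * card R + B * (card R)\<^sup>2) + (2 * card R + B * (card R)\<^sup>2)"
    using sum_card_floor_events[OF assms] sum_card_ceiling_events[OF assms] vertices_bound[OF assms]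
      sum_bounded_above[of R "\<lambda>s. card (meets (R - {s}) s)" "B * card R"] m
    by (intro add_mono) auto
  also have "\<dots> = 4 * card R + 3 * B * (card R)\<^sup>2"
    by (simp add: power2_eq_square algebra_simps)
  finally show ?thesis
    using m sum_card_floor_events[OF assms] sum_card_ceiling_events[OF assms] by (auto simp: events_def)
qed

definition free_points :: "(real \<times> real) set \<Rightarrow> 'a set \<Rightarrow> (real \<times> real) set" where
  "free_points P R = {p \<in> P. \<forall>a\<in>R. \<not> passes a p}"

definition join_rel :: "(real \<times> real) set \<Rightarrow> 'a set \<Rightarrow> ((real \<times> real) \<times> (real \<times> real)) set" where
  "join_rel P R = {(p, q). p \<in> free_points P R \<and> q \<in> free_points P R \<and> joined R p q}"

definition cells :: "(real \<times> real) set \<Rightarrow> 'a set \<Rightarrow> (real \<times> real) set set" where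
  "cells P R = free_points P R // join_rel P R"

lemma equiv_join_rel: "equiv (free_points P R) (join_rel P R)"
  by (rule equivI) (auto simp: join_rel_def refl_on_def sym_def trans_def joined_refl
      dest: joined_sym joined_trans)

text \<open>
The \<open>E\<close> events cut \<open>s\<close> into \<open>E + 1\<close> open pieces, each inside one cell, and the \<open>E\<close> points between
them can lie in further cells.
\<close>

lemma card_cells_met_le:
  assumes R: "finite R" "R \<subseteq> A" and s: "s \<in> A" and P: "finite P" and E: "finite (events R s)"
  shows "card {G \<in> cells P R. \<exists>p\<in>G. passes s p} \<le> 2 * card (events R s) + 1"
proof -
  let ?C = "{G \<in> cells P R. \<exists>p\<in>G. passes s p}" and ?E = "events R s"
  \<comment> \<open>Twice the number of events to the left, plus one at an event: this numbers gaps and events from left to right.\<close>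
  define key where "key = (\<lambda>x. 2 * card {e\<in>?E. e < x} + (if x \<in> ?E then 1 else 0))"
  define pt where "pt = (\<lambda>G. SOME p. p \<in> G \<and> passes s p)"
  have pt: "pt G \<in> G" "passes s (pt G)" if "G \<in> ?C" for G
    using that someI_ex[of "\<lambda>p. p \<in> G \<and> passes s p"] unfolding pt_def by blast+
  have eqv: "equiv (free_points P R) (join_rel P R)" by (rule equiv_join_rel)
  have eq: "G = H" if G: "G \<in> ?C" and H: "H \<in> ?C" and k: "key (fst (pt G)) = key (fst (pt H))"
    and le: "fst (pt G) \<le> fst (pt H)" for G H
  proof -
    let ?u = "fst (pt G)" and ?v = "fst (pt H)"
    have on: "over s ?u" "over s ?v" "pt G = (?u, h s ?u)" "pt H = (?v, h s ?v)"
      using pt[OF G] pt[OF H] by (auto simp: passes_def prod_eq_iff)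
    have "joined R (pt G) (pt H)"
    proof (cases "?u = ?v")
      case True
      then show ?thesis using on joined_refl by metis
    next
      case False
      then have lt: "?u < ?v" using le by simp
      have ne: "(?u \<in> ?E) = (?v \<in> ?E)" "card {e\<in>?E. e < ?u} = card {e\<in>?E. e < ?v}"
        using k unfolding key_def by (auto split: if_splits; presburger)+
      then have same: "{e\<in>?E. e < ?u} = {e\<in>?E. e < ?v}"
        using lt E by (intro card_subset_eq) auto
      then have "?u \<notin> ?E" using lt by blast
      then have "?v \<notin> ?E" using ne by simp
      have "e \<notin> ?E" if "e \<in> {?u..?v}" for e
      proof
        assume e: "e \<in> ?E"
        then have "e < ?v" using that \<open>?v \<notin> ?E\<close> by (cases "e = ?v") auto
        then have "e \<in> {e\<in>?E. e < ?u}" using same e by blast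
        then show False using that by simp
      qed
      then have "{?u..?v} \<inter> ?E = {}" by blast
      then show ?thesis using joined_if_no_event[OF R s on(1,2) le] on by metis
    qed
    moreover have "pt G \<in> free_points P R" "pt H \<in> free_points P R"
      using pt[OF G] pt[OF H] G H in_quotient_imp_subset[OF eqv] by (auto simp: cells_def)
    ultimately have "(pt G, pt H) \<in> join_rel P R" by (simp add: join_rel_def)
    then show ?thesis
      using quotient_eqI[OF eqv] G H pt[OF G] pt[OF H] by (auto simp: cells_def)
  qed
  have "inj_on (\<lambda>G. key (fst (pt G))) ?C"
  proof (rule inj_onI)
    fix G H assume *: "G \<in> ?C" "H \<in> ?C" "key (fst (pt G)) = key (fst (pt H))"
    show "G = H"
      using eq[OF *] eq[OF *(2,1) *(3)[symmetric]] linorder_linear[of "fst (pt G)" "fst (pt H)"] by blast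
  qed
  moreover have "(\<lambda>G. key (fst (pt G))) ` ?C \<subseteq> {..2 * card ?E}"
  proof (intro image_subsetI, simp)
    fix G
    let ?x = "fst (pt G)"
    show "key ?x \<le> 2 * card ?E"
    proof (cases "?x \<in> ?E")
      case True
      then have "{e\<in>?E. e < ?x} \<subset> ?E" by auto
      then have "card {e\<in>?E. e < ?x} < card ?E" using E by (rule psubset_card_mono[rotated])
      then show ?thesis by (simp add: key_def)
    next
      case False
      then show ?thesis using E by (auto simp: key_def intro: card_mono)
    qed
  qed
  ultimately have "card ?C \<le> card {..2 * card ?E}"
    by (intro card_inj_on_le) auto
  then show ?thesis by simp
qed

end

section \<open>Counting incidences inside one cell, and averaging over subsets\<close>

lemma le_add_power_divide:
  fixes u l :: real
  assumes "0 \<le> u" "0 < l" "0 < k"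
  shows "u \<le> l + u ^ k / l ^ (k - 1)"
proof (cases "u \<le> l")
  case True
  then show ?thesis using assms by (simp add: add_increasing2)
next
  case False
  have "u * l ^ (k - 1) \<le> u * u ^ (k - 1)"
    using False assms by (intro mult_left_mono power_mono) auto
  also have "\<dots> = u ^ k" using assms by (simp add: power_eq_if)
  finally have "u \<le> u ^ k / l ^ (k - 1)" using assms by (simp add: field_simps)
  then show ?thesis using assms by simp
qed

text \<open>
An arc with \<open>t\<close> points in a cell is charged to the \<open>k\<close>-subsets of these points. The parameter \<open>l\<close> trades
the charge per arc against the charge per \<open>k\<close>-subset.
\<close>

lemma le_binomial_tradeoff:
  assumes "0 < k" "0 < (l::real)"
  shows "real t \<le> real k + real k * l + real k * real (t choose k) / l ^ (k - 1)"
proof (cases "t < k")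
  case True
  then show ?thesis using assms by (simp add: add_increasing2)
next
  case False
  have "real t / real k \<le> l + (real t / real k) ^ k / l ^ (k - 1)"
    using assms by (intro le_add_power_divide) auto
  also have "\<dots> \<le> l + real (t choose k) / l ^ (k - 1)"
    using binomial_ge_n_over_k_pow_k[of k t, where 'a = real] False assms by (simp add: divide_right_mono)
  finally have "real k * (real t / real k) \<le> real k * (l + real (t choose k) / l ^ (k - 1))"
    by (rule mult_left_mono) simp
  then show ?thesis using assms by (simp add: algebra_simps)
qed

text \<open>
Replaces the concave function \<open>x powr a\<close> by a linear one that is sharp near \<open>x = D\<close>. This makes
linearity of expectation applicable to a power of the number of arcs that meet a cell.
\<close>

lemma powr_le_tangent:
  fixes x D a :: real
  assumes "0 \<le> x" "0 < D" "0 \<le> a" "a \<le> 1"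
  shows "x powr a \<le> D powr a * (1 + x / D)"
proof -
  have "(x / D) powr a \<le> 1 + x / D"
  proof (cases "x \<le> D")
    case True
    have "(x / D) powr a \<le> 1" using assms True by (intro powr_le1) auto
    then show ?thesis using assms by (simp add: add_increasing2)
  next
    case False
    then have "(x / D) powr a \<le> (x / D) powr 1" using assms by (intro powr_mono) auto
    then show ?thesis using assms by simp
  qed
  then have "D powr a * (x / D) powr a \<le> D powr a * (1 + x / D)" by (intro mult_left_mono) auto
  then show ?thesis using assms by (simp add: powr_divide)
qed

text \<open>
Double counting of the pairs of an element of \<open>S\<close> and a \<open>k\<close>-subset of \<open>G\<close> on it.
\<close>

lemma sum_binomial_incidences_le:
  fixes on :: "'s \<Rightarrow> 'p \<Rightarrow> bool"
  assumes "finite G" "finite S"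
    and few: "\<And>T. T \<subseteq> G \<Longrightarrow> card T = k \<Longrightarrow> card {s \<in> S. \<forall>p\<in>T. on s p} \<le> C"
  shows "(\<Sum>s\<in>S. card {p \<in> G. on s p} choose k) \<le> C * (card G choose k)"
proof -
  let ?\<T> = "{T. T \<subseteq> G \<and> card T = k}"
  have fin: "finite ?\<T>" using assms by simp
  have "(\<Sum>s\<in>S. card {p \<in> G. on s p} choose k) = (\<Sum>s\<in>S. card {T \<in> ?\<T>. \<forall>p\<in>T. on s p})"
  proof (rule sum.cong[OF refl])
    fix s
    have "{T \<in> ?\<T>. \<forall>p\<in>T. on s p} = {T. T \<subseteq> {p \<in> G. on s p} \<and> card T = k}" by auto
    then show "card {p \<in> G. on s p} choose k = card {T \<in> ?\<T>. \<forall>p\<in>T. on s p}"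
      using assms by (simp add: n_subsets)
  qed
  also have "\<dots> = (\<Sum>T\<in>?\<T>. card {s \<in> S. \<forall>p\<in>T. on s p})"
    by (rule sum_multicount_gen) (use assms fin in auto)
  also have "\<dots> \<le> (\<Sum>T\<in>?\<T>. C)" by (intro sum_mono) (use few in auto)
  also have "\<dots> = C * (card G choose k)" using assms by (simp add: n_subsets)
  finally show ?thesis .
qed

text \<open>
The bound of Kovari, Sos and Turan for \<open>m\<close> points and \<open>n\<close> arcs, in the form \<open>n + m n\<^sup>1\<^sup>-\<^sup>1\<^sup>/\<^sup>k\<close>,
with the power made linear around an arbitrary value \<open>D\<close>.
\<close>

lemma incidences_in_cell_le:
  fixes on :: "'s \<Rightarrow> 'p \<Rightarrow> bool" and D :: real
  assumes fin: "finite G" "finite S" and k: "0 < k" and D: "0 < D"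
    and few: "\<And>T. T \<subseteq> G \<Longrightarrow> card T = k \<Longrightarrow> card {s \<in> S. \<forall>p\<in>T. on s p} \<le> C"
  defines "n \<equiv> real (card {s \<in> S. \<exists>p\<in>G. on s p})" and "m \<equiv> real (card G)"
  shows "(\<Sum>s\<in>S. real (card {p \<in> G. on s p})) \<le>
    k * n + real k * (1 + real C) * D powr (1 - 1 / k) * (m + m * n / D)"
proof (cases "n = 0 \<or> m = 0")
  case True
  have "card {p \<in> G. on s p} = 0" if "s \<in> S" for s
  proof (cases "m = 0")
    case False
    then have "{s \<in> S. \<exists>p\<in>G. on s p} = {}" using True fin by (simp add: n_def)
    then have "{p \<in> G. on s p} = {}" using that by auto
    then show ?thesis by (metis card.empty)
  qed (use fin in \<open>simp add: m_def\<close>)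
  then have "(\<Sum>s\<in>S. real (card {p \<in> G. on s p})) = 0" by simp
  moreover have "0 \<le> k * n + real k * (1 + real C) * D powr (1 - 1 / k) * (m + m * n / D)"
    using D by (simp add: n_def m_def)
  ultimately show ?thesis by linarith
next
  case False
  then have n: "0 < n" and m: "0 < m" by (auto simp: n_def m_def)
  \<comment> \<open>With this choice the arcs and the \<open>k\<close>-subsets carry the same total charge, up to a constant factor.\<close>
  define l where "l = m * n powr (- 1 / k)"
  have l: "0 < l" using n m by (simp add: l_def)
  let ?S = "{s \<in> S. \<exists>p\<in>G. on s p}" and ?t = "\<lambda>s. card {p \<in> G. on s p}"
  have choose: "real (\<Sum>s\<in>S. ?t s choose k) \<le> C * m ^ k"
  proof -
    have "card G choose k \<le> card G ^ k"
      by (cases "k \<le> card G") (auto intro: binomial_le_pow simp: binomial_eq_0)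
    then have "(\<Sum>s\<in>S. ?t s choose k) \<le> C * card G ^ k"
      using sum_binomial_incidences_le[of G S k on C, OF fin few] by (meson le_trans mult_le_mono2)
    then show ?thesis unfolding m_def by (metis of_nat_le_iff of_nat_mult of_nat_power)
  qed
  have "(\<Sum>s\<in>S. real (?t s)) = (\<Sum>s\<in>?S. real (?t s))"
    using fin by (intro sum.mono_neutral_right) (auto simp: card_eq_0_iff)
  also have "\<dots> \<le> (\<Sum>s\<in>?S. real k + real k * l + real k * real (?t s choose k) / l ^ (k - 1))"
    by (intro sum_mono le_binomial_tradeoff k l)
  also have "\<dots> = k * n + k * (n * l) + k * (\<Sum>s\<in>?S. real (?t s choose k)) / l ^ (k - 1)"
    by (simp add: sum.distrib n_def sum_distrib_left sum_divide_distrib algebra_simps)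
  also have "\<dots> \<le> k * n + k * (n * l) + k * (C * m ^ k) / l ^ (k - 1)"
  proof -
    have "(\<Sum>s\<in>?S. real (?t s choose k)) \<le> (\<Sum>s\<in>S. real (?t s choose k))"
      using fin by (intro sum_mono2) auto
    also have "\<dots> \<le> C * m ^ k" using choose by simp
    finally show ?thesis using l by (intro add_left_mono divide_right_mono mult_left_mono) auto
  qed
  also have "n * l = m * n powr (1 - 1 / k)"
    using n by (simp add: l_def powr_diff powr_minus_divide field_simps)
  also have "k * (C * m ^ k) / l ^ (k - 1) = real k * real C * (m * n powr (1 - 1 / k))"
  proof -
    have "l ^ (k - 1) = m ^ (k - 1) * (n powr (- 1 / k)) ^ (k - 1)"
      by (simp add: l_def power_mult_distrib)
    also have "(n powr (- 1 / k)) ^ (k - 1) = n powr (- (1 - 1 / k))"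
      using n k by (simp add: powr_power of_nat_diff field_simps)
    finally have "l ^ (k - 1) = m ^ (k - 1) * n powr (- (1 - 1 / k))" .
    moreover have "m ^ k = m * m ^ (k - 1)" using k by (simp add: power_eq_if)
    moreover have "n powr (1 - 1 / k) * n powr (- (1 - 1 / k)) = 1"
      using n by (subst powr_add[symmetric]) simp
    ultimately show ?thesis using n m by (simp add: field_simps)
  qed
  also have "k * n + k * (m * n powr (1 - 1 / k)) + real k * real C * (m * n powr (1 - 1 / k))
      = k * n + real k * (1 + real C) * (m * n powr (1 - 1 / k))"
    by (simp add: algebra_simps)
  also have "\<dots> \<le> k * n + real k * (1 + real C) * (m * (D powr (1 - 1 / k) * (1 + n / D)))"
    using n m D k by (intro add_left_mono mult_left_mono powr_le_tangent) auto
  also have "m * (D powr (1 - 1 / k) * (1 + n / D)) = D powr (1 - 1 / k) * (m + m * n / D)"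
    by (simp add: distrib_left)
  finally show ?thesis by (simp add: mult.assoc)
qed

text \<open>
A set of \<open>r\<close> elements together with one more element is the same as a set of \<open>r + 1\<close> elements with one of
them distinguished. A sum over the first kind of pair is therefore analysed backwards, by removing an
element from the larger set.
\<close>

lemma sum_subsets_Suc:
  fixes F :: "'a set \<Rightarrow> 'a \<Rightarrow> 'b::comm_monoid_add"
  assumes A: "finite A"
  shows "(\<Sum>R\<in>{R. R \<subseteq> A \<and> card R = r}. \<Sum>s\<in>A - R. F R s) =
    (\<Sum>R\<in>{R. R \<subseteq> A \<and> card R = Suc r}. \<Sum>s\<in>R. F (R - {s}) s)"
proof -
  have fin: "\<And>R. R \<subseteq> A \<Longrightarrow> finite R" using A finite_subset by blast
  have "(\<Sum>R\<in>{R. R \<subseteq> A \<and> card R = r}. \<Sum>s\<in>A - R. F R s) =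
      (\<Sum>(R, s)\<in>Sigma {R. R \<subseteq> A \<and> card R = r} (\<lambda>R. A - R). F R s)"
    using A by (intro sum.Sigma) auto
  also have "\<dots> = (\<Sum>(R, s)\<in>Sigma {R. R \<subseteq> A \<and> card R = Suc r} (\<lambda>R. R). F (R - {s}) s)"
    by (rule sum.reindex_bij_witness[of _ "\<lambda>(R, s). (R - {s}, s)" "\<lambda>(R, s). (insert s R, s)"])
       (use A fin in \<open>auto simp: insert_absorb\<close>)
  also have "\<dots> = (\<Sum>R\<in>{R. R \<subseteq> A \<and> card R = Suc r}. \<Sum>s\<in>R. F (R - {s}) s)"
    using A fin by (intro sum.Sigma[symmetric]) auto
  finally show ?thesis .
qed

lemma sum_over_subsets:
  fixes g :: "'a \<Rightarrow> real"
  assumes A: "finite A" and "r \<le> card A"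
  shows "card A * (\<Sum>R\<in>{R. R \<subseteq> A \<and> card R = r}. \<Sum>s\<in>R. g s) =
    r * (card A choose r) * (\<Sum>s\<in>A. g s)"
  using \<open>r \<le> card A\<close>
proof (induction r)
  case 0
  have "{R. R \<subseteq> A \<and> card R = 0} = {{}}" using A finite_subset by fastforce
  then show ?case by simp
next
  case (Suc r)
  let ?X = "\<lambda>r. \<Sum>R\<in>{R. R \<subseteq> A \<and> card R = r}. \<Sum>s\<in>R. g s" and ?N = "card A"
  have "?X (Suc r) = (\<Sum>R\<in>{R. R \<subseteq> A \<and> card R = r}. \<Sum>s\<in>A - R. g s)"
    by (rule sum_subsets_Suc[OF A, of "\<lambda>_. g", symmetric])
  also have "\<dots> = (\<Sum>R\<in>{R. R \<subseteq> A \<and> card R = r}. (\<Sum>s\<in>A. g s) - (\<Sum>s\<in>R. g s))"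
    using A by (intro sum.cong refl sum_diff) auto
  also have "\<dots> = (?N choose r) * (\<Sum>s\<in>A. g s) - ?X r"
    using A by (simp add: sum_subtractf n_subsets)
  finally have X: "?X (Suc r) = (?N choose r) * (\<Sum>s\<in>A. g s) - ?X r" .
  have "?N * ?X (Suc r) = ?N * (?N choose r) * (\<Sum>s\<in>A. g s) - ?N * ?X r"
    unfolding X by (simp add: right_diff_distrib)
  also have "?N * ?X r = r * (?N choose r) * (\<Sum>s\<in>A. g s)"
    using Suc by simp
  finally have "?N * ?X (Suc r) = ?N * (?N choose r) * (\<Sum>s\<in>A. g s) - r * (?N choose r) * (\<Sum>s\<in>A. g s)" .
  then have "?N * ?X (Suc r) = real (?N - r) * real (?N choose r) * (\<Sum>s\<in>A. g s)"
    using Suc.prems by (simp add: of_nat_diff algebra_simps)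
  also have "real (?N - r) * real (?N choose r) = real (Suc r) * real (?N choose Suc r)"
    using binomial_absorb_comp[of ?N r] binomial_absorption[of r ?N]
    by (metis Suc_times_binomial_add binomial_absorb_comp of_nat_mult mult.commute)
  finally show ?case by (simp add: algebra_simps)
qed

section \<open>Random sampling: the incidence bound for arcs\<close>

context arc_system begin

lemma finite_cells:
  assumes "finite P"
  shows "finite (cells P R)" "G \<in> cells P R \<Longrightarrow> finite G" "G \<in> cells P R \<Longrightarrow> G \<subseteq> free_points P R"
    "\<Union>(cells P R) = free_points P R" "disjoint (cells P R)"
proof -
  have eqv: "equiv (free_points P R) (join_rel P R)" by (rule equiv_join_rel)
  have fin: "finite (free_points P R)" using assms by (simp add: free_points_def)
  show un: "\<Union>(cells P R) = free_points P R"
    unfolding cells_def by (rule Union_quotient[OF eqv])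
  show "finite (cells P R)"
    unfolding cells_def by (rule finite_quotient[OF fin]) (auto simp: join_rel_def)
  show sub: "G \<subseteq> free_points P R" if "G \<in> cells P R" using un that by auto
  show "finite G" if "G \<in> cells P R" using sub[OF that] fin finite_subset by blast
  show "disjoint (cells P R)"
    using quotient_disj[OF eqv] by (auto simp: disjoint_def cells_def)
qed

text \<open>
The points of \<open>s\<close> that lie on an arc of \<open>R\<close> are crossings of \<open>s\<close> with that arc, and all others lie in cells.
\<close>

lemma incidences_on_arc_le:
  assumes R: "R \<subseteq> A" and s: "s \<in> A - R" and P: "finite P"
  shows "card {p \<in> P. passes s p} \<le> B * card R + (\<Sum>G\<in>cells P R. card {p \<in> G. passes s p})"
proof -
  have finC: "finite (cells P R)" "\<And>G. G \<in> cells P R \<Longrightarrow> finite G"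
    and un: "\<Union>(cells P R) = free_points P R"
    using finite_cells[OF P] by auto
  have "card {p \<in> P. passes s p} \<le> card ({p \<in> P - free_points P R. passes s p} \<union> (\<Union>G\<in>cells P R. {p \<in> G. passes s p}))"
    by (intro card_mono) (use P finC un in auto)
  also have "\<dots> \<le> card {p \<in> P - free_points P R. passes s p} + (\<Sum>G\<in>cells P R. card {p \<in> G. passes s p})"
    by (intro order_trans[OF card_Un_le] add_left_mono card_UN_le finC)
  also have "card {p \<in> P - free_points P R. passes s p} \<le> card (meets R s)"
  proof (rule card_inj_on_le[where f = fst])
    show "inj_on fst {p \<in> P - free_points P R. passes s p}"
      by (rule inj_onI) (auto simp: passes_def)
    show "fst ` {p \<in> P - free_points P R. passes s p} \<subseteq> meets R s"
      by (fastforce simp: free_points_def meets_def cross_def passes_def)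
    show "finite (meets R s)" using meets_bound[of R s] R s by auto
  qed
  also have "\<dots> \<le> B * card R" using meets_bound[of R s] R s by auto
  finally show ?thesis by simp
qed

text \<open>
Summed over the points, the number of arcs that meet the cell of a point is a sum over pairs of an
arc and a point, which the backwards analysis can handle.
\<close>

lemma sum_cell_crossings_le:
  assumes "finite P"
  shows "(\<Sum>G\<in>cells P R. card G * card {s \<in> A - R. \<exists>p\<in>G. passes s p}) \<le>
    (\<Sum>s\<in>A - R. card {p \<in> P. (\<forall>a\<in>R. \<not> passes a p) \<and> (\<exists>q. passes s q \<and> joined R p q)})"
proof -
  let ?c = "\<lambda>p. card {s \<in> A - R. \<exists>q. passes s q \<and> joined R p q}"
  have eqv: "equiv (free_points P R) (join_rel P R)" by (rule equiv_join_rel)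
  have "(\<Sum>G\<in>cells P R. card G * card {s \<in> A - R. \<exists>p\<in>G. passes s p})
      = (\<Sum>G\<in>cells P R. \<Sum>p\<in>G. card {s \<in> A - R. \<exists>p\<in>G. passes s p})"
    by simp
  also have "\<dots> \<le> (\<Sum>G\<in>cells P R. \<Sum>p\<in>G. ?c p)"
  proof (intro sum_mono card_mono)
    fix G p assume G: "G \<in> cells P R" and p: "p \<in> G"
    have "joined R p q" if "q \<in> G" for q
      using quotient_eq_iff[OF eqv, of G G p q] G p that by (auto simp: cells_def join_rel_def)
    then show "{s \<in> A - R. \<exists>p\<in>G. passes s p} \<subseteq> {s \<in> A - R. \<exists>q. passes s q \<and> joined R p q}"
      by blast
  qed (use finite_arcs in auto)
  also have "\<dots> = (\<Sum>p\<in>free_points P R. ?c p)"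
    unfolding finite_cells(4)[OF assms, of R, symmetric]
    using finite_cells[OF assms]
    by (subst sum.Union_disjoint) (auto simp: disjoint_def)
  also have "\<dots> = (\<Sum>s\<in>A - R. card {p \<in> free_points P R. \<exists>q. passes s q \<and> joined R p q})"
    by (rule sum_multicount_gen[symmetric]) (use assms finite_arcs in \<open>auto simp: free_points_def\<close>)
  also have "\<dots> = (\<Sum>s\<in>A - R. card {p \<in> P. (\<forall>a\<in>R. \<not> passes a p) \<and> (\<exists>q. passes s q \<and> joined R p q)})"
    by (simp add: free_points_def conj_assoc)
  finally show ?thesis .
qed

text \<open>
The average of the bounds for the cells over all \<open>r\<close>-subsets \<open>R\<close> of the arcs. The parameter \<open>D\<close> of the
bound for one cell is \<open>(N - r) / (r + 1)\<close>, which bounds, up to a constant factor, the average number of arcs that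
meet the cell of a point; at the same time it is the quotient of the number of \<open>(r + 1)\<close>-subsets by the number of
\<open>r\<close>-subsets. The condition \<open>2 r \<le> N\<close> makes it comparable with \<open>N / r\<close>.
\<close>

theorem incidences_sampling_bound:
  fixes P :: "(real \<times> real) set"
  assumes P: "finite P" and k: "0 < k" and A: "A \<noteq> {}" and r: "2 * r \<le> card A"
    and few: "\<And>T. T \<subseteq> P \<Longrightarrow> card T = k \<Longrightarrow> card {a \<in> A. \<forall>p\<in>T. passes a p} \<le> C"
  defines "N \<equiv> real (card A)" and "\<rho> \<equiv> real (Suc r)"
  shows "(\<Sum>a\<in>A. real (card {p \<in> P. passes a p})) \<le>
    (real B + real k * (9 + 6 * real B)) * N * \<rho> + 10 * real k * (1 + real C) * card P * (N / \<rho>) powr (1 - 1 / k)"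
proof -
  define I where "I = (\<Sum>a\<in>A. real (card {p \<in> P. passes a p}))"
  define D where "D = (N - r) / \<rho>"
  define c where "c = real (card A choose r)"
  define M where "M = real (card A choose Suc r)"
  define m where "m = real (card P)"
  let ?S = "{R. R \<subseteq> A \<and> card R = r}" and ?S' = "{R. R \<subseteq> A \<and> card R = Suc r}"
  let ?nn = "\<lambda>R G. card {s \<in> A - R. \<exists>p\<in>G. passes s p}"
  let ?J = "real k * (1 + real C) * D powr (1 - 1 / k)"
  have N: "1 \<le> N" "r \<le> N" "Suc r \<le> card A" "2 * r \<le> N"
  proof -
    have "1 \<le> card A" using A finite_arcs by (simp add: Suc_le_eq card_gt_0_iff)
    then show "1 \<le> N" "r \<le> N" "Suc r \<le> card A" "2 * r \<le> N" using r by (auto simp: N_def)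
  qed
  have rho: "1 \<le> \<rho>" by (simp add: \<rho>_def)
  have D: "0 < D" "N / (2 * \<rho>) \<le> D"
  proof -
    have half: "N / 2 \<le> N - r" using N(4) by linarith
    then have "0 < N - r" using N(1) by linarith
    then show "0 < D" unfolding D_def using rho by (intro divide_pos_pos) auto
    have "N / 2 / \<rho> \<le> (N - r) / \<rho>" using half rho by (intro divide_right_mono) auto
    then show "N / (2 * \<rho>) \<le> D" by (simp only: D_def divide_divide_eq_left)
  qed
  have M: "0 < M" using N by (simp add: M_def)
  have cardS: "real (card ?S) = c" "real (card ?S') = M"
    using finite_arcs by (simp_all add: n_subsets c_def M_def)
  have cD: "c = M / D"
  proof -
    have "(card A - r) * (card A choose r) = Suc r * (card A choose Suc r)"
      using binomial_absorb_comp[of "card A" r] binomial_absorption[of r "card A"] by simp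
    then have "(N - r) * c = \<rho> * M"
      unfolding c_def M_def N_def \<rho>_def using N by (metis of_nat_diff of_nat_mult Suc_leD)
    moreover have "0 < N - r" using N by (simp add: N_def)
    ultimately show ?thesis using rho by (simp add: D_def field_simps)
  qed
  have finR: "finite R" if "R \<subseteq> A" for R using that finite_arcs finite_subset by blast
  have total: "(\<Sum>R\<in>?S. \<Sum>s\<in>A - R. real (card {p \<in> P. passes s p})) = \<rho> * M * I / N"
    using sum_over_subsets[OF finite_arcs N(3), of "\<lambda>a. real (card {p \<in> P. passes a p})"] N
    by (subst sum_subsets_Suc[OF finite_arcs]) (simp add: I_def M_def \<rho>_def N_def field_simps)
  have cell: "(\<Sum>s\<in>A - R. real (card {p \<in> G. passes s p})) \<le> k * real (?nn R G) + ?J * (card G + card G * real (?nn R G) / D)"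
    if "G \<in> cells P R" for R G
  proof (rule incidences_in_cell_le[OF _ _ k D(1)])
    show "finite G" "finite (A - R)" using finite_cells[OF P] that finite_arcs by auto
    fix T assume T: "T \<subseteq> G" "card T = k"
    have "card {s \<in> A - R. \<forall>p\<in>T. passes s p} \<le> card {a \<in> A. \<forall>p\<in>T. passes a p}"
      using finite_arcs by (intro card_mono) auto
    also have "\<dots> \<le> C" using T finite_cells(3)[OF P that] by (intro few) (auto simp: free_points_def)
    finally show "card {s \<in> A - R. \<forall>p\<in>T. passes s p} \<le> C" .
  qed
  have one: "(\<Sum>s\<in>A - R. real (card {p \<in> P. passes s p})) \<le>
      (\<Sum>s\<in>A - R. real (B * r + k * card {G \<in> cells P R. \<exists>p\<in>G. passes s p})) + ?J * m +
      ?J / D * (\<Sum>s\<in>A - R. real (card {p \<in> P. (\<forall>a\<in>R. \<not> passes a p) \<and> (\<exists>q. passes s q \<and> joined R p q)}))"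
    if R: "R \<in> ?S" for R
  proof -
    have "(\<Sum>s\<in>A - R. real (card {p \<in> P. passes s p})) \<le>
        (\<Sum>s\<in>A - R. real (B * r) + (\<Sum>G\<in>cells P R. real (card {p \<in> G. passes s p})))"
    proof (rule sum_mono)
      fix s assume "s \<in> A - R"
      then have "card {p \<in> P. passes s p} \<le> B * r + (\<Sum>G\<in>cells P R. card {p \<in> G. passes s p})"
        using incidences_on_arc_le[of R s P] R P by auto
      then show "real (card {p \<in> P. passes s p}) \<le> real (B * r) + (\<Sum>G\<in>cells P R. real (card {p \<in> G. passes s p}))"
        by (metis (mono_tags, lifting) of_nat_le_iff of_nat_add of_nat_sum sum.cong)
    qed
    also have "\<dots> = (\<Sum>s\<in>A - R. real (B * r)) + (\<Sum>G\<in>cells P R. \<Sum>s\<in>A - R. real (card {p \<in> G. passes s p}))"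
      by (simp add: sum.distrib sum.swap[of _ "cells P R"])
    also have "\<dots> \<le> (\<Sum>s\<in>A - R. real (B * r)) + (\<Sum>G\<in>cells P R. k * real (?nn R G) + ?J * (card G + card G * real (?nn R G) / D))"
      by (intro add_left_mono sum_mono cell)
    also have "\<dots> = (\<Sum>s\<in>A - R. real (B * r)) + k * real (\<Sum>G\<in>cells P R. ?nn R G)
        + ?J * real (\<Sum>G\<in>cells P R. card G) + ?J / D * real (\<Sum>G\<in>cells P R. card G * ?nn R G)"
      by (simp add: sum.distrib sum_distrib_left sum_divide_distrib algebra_simps)
    also have "(\<Sum>G\<in>cells P R. ?nn R G) = (\<Sum>s\<in>A - R. card {G \<in> cells P R. \<exists>p\<in>G. passes s p})"
      by (rule sum_multicount_gen[symmetric]) (use finite_cells[OF P] finite_arcs in auto)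
    also have "(\<Sum>G\<in>cells P R. card G) = card (free_points P R)"
      unfolding finite_cells(4)[OF P, of R, symmetric]
      using finite_cells[OF P] by (intro card_Union_disjoint[symmetric]) (auto simp: disjoint_def pairwise_def disjnt_def)
    also have "(\<Sum>s\<in>A - R. real (B * r)) + k * real (\<Sum>s\<in>A - R. card {G \<in> cells P R. \<exists>p\<in>G. passes s p})
        + ?J * real (card (free_points P R)) + ?J / D * real (\<Sum>G\<in>cells P R. card G * ?nn R G)
      \<le> (\<Sum>s\<in>A - R. real (B * r)) + k * real (\<Sum>s\<in>A - R. card {G \<in> cells P R. \<exists>p\<in>G. passes s p})
        + ?J * m + ?J / D * real (\<Sum>s\<in>A - R. card {p \<in> P. (\<forall>a\<in>R. \<not> passes a p) \<and> (\<exists>q. passes s q \<and> joined R p q)})"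
    proof (intro add_mono mult_left_mono order_refl)
      show "real (card (free_points P R)) \<le> m"
        unfolding m_def using P by (auto simp: free_points_def intro: card_mono)
      show "real (\<Sum>G\<in>cells P R. card G * ?nn R G)
        \<le> real (\<Sum>s\<in>A - R. card {p \<in> P. (\<forall>a\<in>R. \<not> passes a p) \<and> (\<exists>q. passes s q \<and> joined R p q)})"
        using sum_cell_crossings_le[OF P] by (intro of_nat_mono)
    qed (use D in auto)
    finally show ?thesis by (simp add: sum.distrib sum_distrib_left)
  qed
  \<comment> \<open>Each \<open>s\<close> is now the element removed from a set of \<open>r + 1\<close> arcs, so that all the events together are charged to the vertices of that set.\<close>
  have cellsum: "(\<Sum>R\<in>?S. \<Sum>s\<in>A - R. real (B * r + k * card {G \<in> cells P R. \<exists>p\<in>G. passes s p}))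
      \<le> M * \<rho> * (real B + real k * (9 + 6 * real B)) * \<rho>"
  proof -
    have "(\<Sum>s\<in>R. real (B * r + k * card {G \<in> cells P (R - {s}). \<exists>p\<in>G. passes s p}))
        \<le> \<rho> * (real B + real k * (9 + 6 * real B)) * \<rho>" if "R \<in> ?S'" for R
    proof -
      have R: "R \<subseteq> A" "finite R" "card R = Suc r" using that finR by auto
      have "(\<Sum>s\<in>R. B * r + k * card {G \<in> cells P (R - {s}). \<exists>p\<in>G. passes s p})
          \<le> (\<Sum>s\<in>R. B * r + k * (2 * card (events (R - {s}) s) + 1))"
        by (intro sum_mono add_left_mono mult_left_mono card_cells_met_le)
           (use R P sum_card_events[OF R(1)] in auto)
      also have "\<dots> = Suc r * (B * r + k) + k * 2 * (\<Sum>s\<in>R. card (events (R - {s}) s))"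
        using R by (simp add: sum.distrib sum_distrib_left algebra_simps)
      also have "\<dots> \<le> Suc r * (B * r + k) + k * 2 * (4 * Suc r + 3 * B * (Suc r)\<^sup>2)"
        using sum_card_events[OF R(1)] R by (intro add_left_mono mult_left_mono) auto
      also have "\<dots> \<le> Suc r * (B + k * (9 + 6 * B)) * Suc r"
        by (simp add: power2_eq_square algebra_simps)
      finally have "real (\<Sum>s\<in>R. B * r + k * card {G \<in> cells P (R - {s}). \<exists>p\<in>G. passes s p})
          \<le> real (Suc r * (B + k * (9 + 6 * B)) * Suc r)" by (rule of_nat_mono)
      then show ?thesis by (simp add: \<rho>_def algebra_simps)
    qed
    then have "(\<Sum>R\<in>?S'. \<Sum>s\<in>R. real (B * r + k * card {G \<in> cells P (R - {s}). \<exists>p\<in>G. passes s p}))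
        \<le> (\<Sum>R\<in>?S'. \<rho> * (real B + real k * (9 + 6 * real B)) * \<rho>)" by (rule sum_mono)
    then show ?thesis
      unfolding sum_subsets_Suc[OF finite_arcs, where r = r] using cardS(2) by (simp add: mult.assoc)
  qed
  \<comment> \<open>Likewise, for a fixed point only the at most four arcs in conflict with it contribute.\<close>
  have confsum: "(\<Sum>R\<in>?S. \<Sum>s\<in>A - R. real (card {p \<in> P. (\<forall>a\<in>R. \<not> passes a p) \<and> (\<exists>q. passes s q \<and> joined R p q)}))
      \<le> M * (4 * m)"
  proof -
    have "(\<Sum>s\<in>R. card {p \<in> P. (\<forall>a\<in>R - {s}. \<not> passes a p) \<and> (\<exists>q. passes s q \<and> joined (R - {s}) p q)})
        \<le> 4 * card P" if "R \<in> ?S'" for R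
    proof -
      have "(\<Sum>s\<in>R. card {p \<in> P. (\<forall>a\<in>R - {s}. \<not> passes a p) \<and> (\<exists>q. passes s q \<and> joined (R - {s}) p q)})
        = (\<Sum>p\<in>P. card (conflicts R p))"
        unfolding conflicts_def by (rule sum_multicount_gen) (use that finR P in auto)
      also have "\<dots> \<le> (\<Sum>p\<in>P. 4)" by (intro sum_mono card_conflicts_le) (use that finR in auto)
      finally show ?thesis by simp
    qed
    note bound = this
    have "(\<Sum>s\<in>R. real (card {p \<in> P. (\<forall>a\<in>R - {s}. \<not> passes a p) \<and> (\<exists>q. passes s q \<and> joined (R - {s}) p q)}))
        \<le> 4 * m" if "R \<in> ?S'" for R
    proof -
      have "real (\<Sum>s\<in>R. card {p \<in> P. (\<forall>a\<in>R - {s}. \<not> passes a p) \<and> (\<exists>q. passes s q \<and> joined (R - {s}) p q)})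
          \<le> real (4 * card P)"
        by (rule of_nat_mono[OF bound[OF that]])
      then show ?thesis by (simp only: of_nat_sum m_def of_nat_mult of_nat_numeral)
    qed
    then have "(\<Sum>R\<in>?S'. \<Sum>s\<in>R. real (card {p \<in> P. (\<forall>a\<in>R - {s}. \<not> passes a p) \<and> (\<exists>q. passes s q \<and> joined (R - {s}) p q)}))
        \<le> (\<Sum>R\<in>?S'. 4 * m)" by (rule sum_mono)
    then show ?thesis
      unfolding sum_subsets_Suc[OF finite_arcs, where r = r] using cardS(2) by simp
  qed
  have "\<rho> * M * I / N \<le> (\<Sum>R\<in>?S. (\<Sum>s\<in>A - R. real (B * r + k * card {G \<in> cells P R. \<exists>p\<in>G. passes s p})) + ?J * m +
      ?J / D * (\<Sum>s\<in>A - R. real (card {p \<in> P. (\<forall>a\<in>R. \<not> passes a p) \<and> (\<exists>q. passes s q \<and> joined R p q)})))"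
    unfolding total[symmetric] by (rule sum_mono[OF one])
  also have "\<dots> = (\<Sum>R\<in>?S. \<Sum>s\<in>A - R. real (B * r + k * card {G \<in> cells P R. \<exists>p\<in>G. passes s p})) + ?J * m * c
     + ?J / D * (\<Sum>R\<in>?S. \<Sum>s\<in>A - R. real (card {p \<in> P. (\<forall>a\<in>R. \<not> passes a p) \<and> (\<exists>q. passes s q \<and> joined R p q)}))"
    using cardS(1) by (simp add: sum.distrib sum_distrib_left)
  also have "\<dots> \<le> M * \<rho> * (real B + real k * (9 + 6 * real B)) * \<rho> + ?J * m * c + ?J / D * (M * (4 * m))"
    using cellsum confsum D by (intro add_mono mult_left_mono order_refl) auto
  also have "\<dots> = M * (\<rho> * (real B + real k * (9 + 6 * real B)) * \<rho> + 5 * (?J / D) * m)"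
  proof -
    define W where "W = ?J / D * m"
    have "?J * m * c = M * W" "?J / D * (M * (4 * m)) = M * (4 * W)" "5 * (?J / D) * m = 5 * W"
      unfolding cD W_def by (simp_all only: times_divide_eq_left times_divide_eq_right mult_ac)
    then show ?thesis by (simp only: distrib_left mult.assoc) (simp add: algebra_simps)
  qed
  finally have "M * (\<rho> * I / N) \<le> M * (\<rho> * (real B + real k * (9 + 6 * real B)) * \<rho> + 5 * (?J / D) * m)"
    by (simp add: mult.assoc mult.left_commute)
  then have "\<rho> * I / N \<le> \<rho> * (real B + real k * (9 + 6 * real B)) * \<rho> + 5 * (?J / D) * m"
    using M by (rule mult_left_le_imp_le)
  then have "I \<le> (real B + real k * (9 + 6 * real B)) * N * \<rho> + 5 * real k * (1 + real C) * m * (N / \<rho> * (D powr (1 - 1 / k) / D))"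
    (is "_ \<le> ?R")
  proof -
    define E where "E = real B + real k * (9 + 6 * real B)"
    assume "\<rho> * I / N \<le> \<rho> * (real B + real k * (9 + 6 * real B)) * \<rho> + 5 * (?J / D) * m"
    then have "N / \<rho> * (\<rho> * I / N) \<le> N / \<rho> * (\<rho> * E * \<rho> + 5 * (?J / D) * m)"
      unfolding E_def using N rho by (intro mult_left_mono) auto
    also have "N / \<rho> * (\<rho> * I / N) = I" using N rho by simp
    also have "N / \<rho> * (\<rho> * E * \<rho> + 5 * (?J / D) * m) = E * N * \<rho> + N / \<rho> * (5 * (?J / D) * m)"
      using rho by (simp add: distrib_left)
    also have "\<dots> = ?R" by (simp add: E_def)
    finally show ?thesis .
  qed
  also have "N / \<rho> * (D powr (1 - 1 / k) / D) \<le> 2 * (N / \<rho>) powr (1 - 1 / k)"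
  proof -
    have "D powr (1 - 1 / k) / D = D powr (- 1 / k)"
      using D by (simp add: powr_diff powr_minus_divide)
    also have "\<dots> \<le> (N / (2 * \<rho>)) powr (- 1 / k)"
      using D N rho by (intro powr_mono2') auto
    also have "\<dots> = 2 powr (1 / k) * (N / \<rho>) powr (- 1 / k)"
      using N rho by (simp add: powr_divide powr_mult powr_minus_divide)
    also have "\<dots> \<le> 2 powr 1 * (N / \<rho>) powr (- 1 / k)"
      using k by (intro mult_right_mono powr_mono) auto
    finally have "N / \<rho> * (D powr (1 - 1 / k) / D) \<le> N / \<rho> * (2 * (N / \<rho>) powr (- 1 / k))"
      using N rho by (intro mult_left_mono) auto
    also have "\<dots> = 2 * (N / \<rho>) powr (1 - 1 / k)"
      using N rho by (simp add: powr_diff powr_minus_divide)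
    finally show ?thesis .
  qed
  finally show ?thesis
    unfolding I_def m_def by (simp add: mult_left_mono mult.assoc)
qed


text \<open>
The two summands of the sampling bound agree, and equal \<open>T\<close> below, when the sample size is the number
\<open>X\<close>. If \<open>X\<close> is less than \<open>1\<close>, the empty sample gives \<open>O(T + N)\<close>; if it exceeds \<open>N / 2\<close>, a sample of half of the arcs
gives \<open>O(T + m + N)\<close>.
\<close>

theorem incidences_bound:
  fixes P :: "(real \<times> real) set" and k C :: nat
  assumes P: "finite P" "P \<noteq> {}" and k: "0 < k" and A: "A \<noteq> {}"
    and few: "\<And>T. T \<subseteq> P \<Longrightarrow> card T = k \<Longrightarrow> card {a \<in> A. \<forall>p\<in>T. passes a p} \<le> C"
  defines "N \<equiv> real (card A)" and "m \<equiv> real (card P)"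
  shows "(\<Sum>a\<in>A. real (card {p \<in> P. passes a p})) \<le>
    (real B + real k * (9 + 6 * real B) + 20 * real k * (1 + real C)) *
      (m powr (k / (2 * real k - 1)) * N powr ((2 * real k - 2) / (2 * real k - 1)) + m + N)"
proof -
  define I where "I = (\<Sum>a\<in>A. real (card {p \<in> P. passes a p}))"
  define K1 where "K1 = real B + real k * (9 + 6 * real B)"
  define K2 where "K2 = 10 * real k * (1 + real C)"
  define X where "X = m powr (k / (2 * real k - 1)) * N powr (- 1 / (2 * real k - 1))"
  define T where "T = m powr (k / (2 * real k - 1)) * N powr ((2 * real k - 2) / (2 * real k - 1))"
  define \<beta> where "\<beta> = 1 - 1 / real k"
  have pos: "1 \<le> N" "1 \<le> m"
    using A P finite_arcs by (auto simp: N_def m_def Suc_le_eq card_gt_0_iff)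
  have K: "0 \<le> K1" "0 \<le> K2" by (simp_all add: K1_def K2_def)
  have \<beta>: "0 \<le> \<beta>" "\<beta> \<le> 1" using k by (auto simp: \<beta>_def)
  have kk: "0 < 2 * real k - 1" using k by auto
  have X: "0 < X" using pos by (simp add: X_def)
  have T: "0 < T" using pos by (simp add: T_def)
  have NX: "N * X = T"
  proof -
    have "N * N powr (- 1 / (2 * real k - 1)) = N powr (1 + - 1 / (2 * real k - 1))"
      using pos by (subst powr_add) simp
    also have "1 + - 1 / (2 * real k - 1) = (2 * real k - 2) / (2 * real k - 1)"
      using kk by (simp add: field_simps)
    finally show ?thesis by (simp add: X_def T_def mult.left_commute)
  qed
  \<comment> \<open>The exponents of \<open>m\<close> and \<open>N\<close> are compared after taking logarithms.\<close>
  have mX: "m * (N / X) powr \<beta> = T"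
  proof -
    have "ln (m * (N / X) powr \<beta>) = ln m + \<beta> * (ln N - (k / (2 * real k - 1) * ln m + - 1 / (2 * real k - 1) * ln N))"
      using pos X by (simp add: ln_mult ln_powr ln_div X_def)
    also have "\<dots> = (1 - \<beta> * (k / (2 * real k - 1))) * ln m + \<beta> * (1 + 1 / (2 * real k - 1)) * ln N"
      by (simp add: algebra_simps)
    also have "1 - \<beta> * (k / (2 * real k - 1)) = k / (2 * real k - 1)"
      using kk k by (simp add: \<beta>_def field_simps)
    also have "\<beta> * (1 + 1 / (2 * real k - 1)) = (2 * real k - 2) / (2 * real k - 1)"
      using kk k by (simp add: \<beta>_def field_simps)
    also have "k / (2 * real k - 1) * ln m + (2 * real k - 2) / (2 * real k - 1) * ln N = ln T"
      using pos by (simp add: T_def ln_mult ln_powr)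
    finally show ?thesis using pos X T by (subst (asm) ln_inj_iff) auto
  qed
  have main: "I \<le> K1 * (N * real (Suc r)) + K2 * (m * (N / real (Suc r)) powr \<beta>)" if "2 * r \<le> card A" for r
    using incidences_sampling_bound[OF P(1) k A that few]
    by (simp add: I_def K1_def K2_def N_def m_def \<beta>_def mult.assoc)
  have "\<exists>r. 2 * r \<le> card A \<and> N * real (Suc r) \<le> T + N \<and> (N / real (Suc r)) powr \<beta> \<le> 2 * max 1 ((N / X) powr \<beta>)"
  proof -
    consider "X < 1" | "1 \<le> X" "X \<le> N / 2" | "N / 2 < X" by linarith
    then show ?thesis
    proof cases
      case 1
      have "N powr \<beta> \<le> (N / X) powr \<beta>"
        using 1 X pos \<beta> by (intro powr_mono2) (auto simp: field_simps)
      then show ?thesis using T by (intro exI[of _ 0]) auto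
    next
      case 2
      define r where "r = nat \<lfloor>X\<rfloor> - 1"
      have r: "real (Suc r) = \<lfloor>X\<rfloor>" using 2 by (simp add: r_def)
      have "1 \<le> \<lfloor>X\<rfloor>" using 2 by simp
      then have "1 \<le> real_of_int \<lfloor>X\<rfloor>" by simp
      then have le: "real (Suc r) \<le> X" "X / 2 \<le> real (Suc r)"
        unfolding r using floor_le_iff[of X "\<lfloor>X\<rfloor>"] by linarith+
      have "N / real (Suc r) \<le> N / (X / 2)"
        using le X pos by (intro divide_left_mono) auto
      then have "(N / real (Suc r)) powr \<beta> \<le> (2 * (N / X)) powr \<beta>"
        using pos \<beta> by (intro powr_mono2) (auto simp: mult.commute)
      also have "\<dots> = 2 powr \<beta> * (N / X) powr \<beta>" using pos X by (intro powr_mult)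
      also have "\<dots> \<le> 2 powr 1 * (N / X) powr \<beta>" using \<beta> by (intro mult_right_mono powr_mono) auto
      finally have "(N / real (Suc r)) powr \<beta> \<le> 2 * max 1 ((N / X) powr \<beta>)" by simp
      moreover have "N * real (Suc r) \<le> N * X" using le pos by (intro mult_left_mono) auto
      moreover have "2 * r \<le> card A" using le 2 by (simp add: N_def)
      ultimately show ?thesis using NX pos by (intro exI[of _ r]) auto
    next
      case 3
      define r where "r = card A div 2"
      have le: "N / 2 \<le> real (Suc r)" "real r \<le> N / 2" unfolding r_def N_def by linarith+
      have "(N / real (Suc r)) powr \<beta> \<le> 2 powr \<beta>"
        using le pos \<beta> by (intro powr_mono2) (auto simp: field_simps)
      also have "\<dots> \<le> 2 powr 1" using \<beta> by (intro powr_mono) auto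
      finally have "(N / real (Suc r)) powr \<beta> \<le> 2 * max 1 ((N / X) powr \<beta>)" by simp
      moreover have "N * real (Suc r) \<le> N * X + N"
      proof -
        have "N * real r \<le> N * X" using le 3 pos by (intro mult_left_mono) auto
        then show ?thesis by (simp add: algebra_simps)
      qed
      ultimately show ?thesis using NX by (intro exI[of _ r]) (auto simp: r_def)
    qed
  qed
  then obtain r where r: "2 * r \<le> card A" "N * real (Suc r) \<le> T + N"
    "(N / real (Suc r)) powr \<beta> \<le> 2 * max 1 ((N / X) powr \<beta>)" by auto
  have "m * (N / real (Suc r)) powr \<beta> \<le> m * (2 * max 1 ((N / X) powr \<beta>))"
    using r pos by (intro mult_left_mono) auto
  also have "\<dots> = 2 * max m T"
    using pos mX by (simp add: max_def mult.left_commute) (smt (verit) mult_le_cancel_left1)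
  also have "\<dots> \<le> 2 * (T + m)" using T pos by auto
  finally have "I \<le> K1 * (T + N) + K2 * (2 * (T + m))"
    using main[OF r(1)] r(2) K by (smt (verit) mult_left_mono)
  also have "\<dots> \<le> K1 * (T + m + N) + K2 * (2 * (T + m + N))"
    by (rule add_mono; rule mult_left_mono) (use K pos in auto)
  finally show ?thesis
    unfolding I_def K1_def K2_def T_def by (simp add: algebra_simps)
qed

end

section \<open>Bivariate polynomials, prime factors and resultants\<close>

lemma total_degree_ge: "coeff (coeff g j) i \<noteq> 0 \<Longrightarrow> i + j \<le> total_degree g"
  using total_degree_le_iff[of g "total_degree g"] by blast

text \<open>
Among the monomials of top degree, one with the largest power of \<open>y\<close>. These monomials of two polynomials have a
product that no other pair of monomials can cancel.
\<close>

lemma total_degree_attained: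
  assumes "g \<noteq> 0"
  obtains i j where "coeff (coeff g j) i \<noteq> 0" "i + j = total_degree g"
    "\<And>i' j'. \<lbrakk>coeff (coeff g j') i' \<noteq> 0; i' + j' = total_degree g\<rbrakk> \<Longrightarrow> j' \<le> j"
proof -
  let ?J = "{j. \<exists>i. coeff (coeff g j) i \<noteq> 0 \<and> i + j = total_degree g}"
  have "\<exists>i j. coeff (coeff g j) i \<noteq> 0 \<and> i + j = total_degree g"
  proof (rule ccontr)
    assume none: "\<not> ?thesis"
    have "coeff (coeff g (degree g)) (degree (coeff g (degree g))) \<noteq> 0"
      using assms by simp
    then have "degree (coeff g (degree g)) + degree g \<le> total_degree g"
      "degree (coeff g (degree g)) + degree g \<noteq> total_degree g"
      using none total_degree_ge by blast+
    then have "0 < total_degree g" by linarith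
    moreover have "total_degree g \<le> total_degree g - 1"
      unfolding total_degree_le_iff
    proof (intro allI impI)
      fix i j assume "coeff (coeff g j) i \<noteq> 0"
      then have "i + j \<le> total_degree g" "i + j \<noteq> total_degree g"
        using none total_degree_ge by blast+
      then show "i + j \<le> total_degree g - 1" by linarith
    qed
    ultimately show False by simp
  qed
  then have "?J \<noteq> {}" by auto
  moreover have "finite ?J" by (rule finite_subset[of _ "{..total_degree g}"]) auto
  ultimately have "Max ?J \<in> ?J" "\<And>j. j \<in> ?J \<Longrightarrow> j \<le> Max ?J"
    using Max_in[of ?J] Max_ge[of ?J] by blast+
  then show ?thesis using that by blast
qed

lemma total_degree_mult:
  assumes "f \<noteq> 0" "g \<noteq> 0"
  shows "total_degree f + total_degree g \<le> total_degree (f * g)"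
proof -
  obtain i1 j1 where 1: "coeff (coeff f j1) i1 \<noteq> 0" "i1 + j1 = total_degree f"
    "\<And>i' j'. \<lbrakk>coeff (coeff f j') i' \<noteq> 0; i' + j' = total_degree f\<rbrakk> \<Longrightarrow> j' \<le> j1"
    using total_degree_attained[OF assms(1)] by metis
  obtain i2 j2 where 2: "coeff (coeff g j2) i2 \<noteq> 0" "i2 + j2 = total_degree g"
    "\<And>i' j'. \<lbrakk>coeff (coeff g j') i' \<noteq> 0; i' + j' = total_degree g\<rbrakk> \<Longrightarrow> j' \<le> j2"
    using total_degree_attained[OF assms(2)] by metis
  let ?t = "\<lambda>j i. coeff (coeff f j) i * coeff (coeff g (j1 + j2 - j)) (i1 + i2 - i)"
  have "coeff (coeff (f * g) (j1 + j2)) (i1 + i2) = (\<Sum>j\<le>j1 + j2. \<Sum>i\<le>i1 + i2. ?t j i)"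
    by (simp add: coeff_mult coeff_sum)
  also have "\<dots> = (\<Sum>(j, i)\<in>{..j1 + j2} \<times> {..i1 + i2}. ?t j i)"
    by (simp add: sum.cartesian_product)
  also have "\<dots> = (\<Sum>(j, i)\<in>{(j1, i1)}. ?t j i)"
  proof (rule sum.mono_neutral_right)
    show "\<forall>z\<in>{..j1 + j2} \<times> {..i1 + i2} - {(j1, i1)}. (case z of (j, i) \<Rightarrow> ?t j i) = 0"
    proof (rule ballI, rule ccontr)
      fix z assume z: "z \<in> {..j1 + j2} \<times> {..i1 + i2} - {(j1, i1)}" "(case z of (j, i) \<Rightarrow> ?t j i) \<noteq> 0"
      obtain j i where "z = (j, i)" by (cases z)
      then have ji: "(j, i) \<noteq> (j1, i1)" "j \<le> j1 + j2" "i \<le> i1 + i2" "?t j i \<noteq> 0"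
        using z by auto
      then have nz: "coeff (coeff f j) i \<noteq> 0" "coeff (coeff g (j1 + j2 - j)) (i1 + i2 - i) \<noteq> 0" by auto
      have "i + j \<le> total_degree f" "(i1 + i2 - i) + (j1 + j2 - j) \<le> total_degree g"
        using nz total_degree_ge by blast+
      then have "i + j = total_degree f" "(i1 + i2 - i) + (j1 + j2 - j) = total_degree g"
        using ji 1(2) 2(2) by linarith+
      then have "j \<le> j1" "j1 + j2 - j \<le> j2" using 1(3) 2(3) nz by blast+
      then show False using ji \<open>i + j = total_degree f\<close> 1(2) by auto
    qed
  qed auto
  also have "\<dots> \<noteq> 0" using 1 2 by simp
  finally have "(i1 + i2) + (j1 + j2) \<le> total_degree (f * g)" by (rule total_degree_ge)
  then show ?thesis using 1 2 by linarith
qed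

lemma total_degree_dvd: "f dvd g \<Longrightarrow> g \<noteq> 0 \<Longrightarrow> total_degree f \<le> total_degree g"
  using total_degree_mult by (metis add_leD1 dvdE mult_zero_left mult_zero_right)

lemma degree_le_total_degree: "degree g \<le> total_degree g"
proof (cases "g = 0")
  case False
  then have "coeff (coeff g (degree g)) (degree (coeff g (degree g))) \<noteq> 0" by simp
  then show ?thesis using total_degree_ge by fastforce
qed simp

lemma degree_coeff_le_total_degree: "degree (coeff g j) \<le> total_degree g"
proof (cases "coeff g j = 0")
  case False
  then have "coeff (coeff g j) (degree (coeff g j)) \<noteq> 0" by simp
  then show ?thesis using total_degree_ge by fastforce
qed simp

lemma total_degree_0_imp_const:
  assumes "total_degree g = 0"
  obtains c where "g = [:[:c:]:]"
proof -
  obtain a where a: "g = [:a:]" using degree_le_total_degree[of g] assms degree_eq_zeroE[of g] by auto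
  moreover obtain c where "a = [:c:]"
    using degree_coeff_le_total_degree[of g 0] assms degree_eq_zeroE[of a] a by auto
  ultimately show ?thesis using that by simp
qed

lemma total_degree_prime:
  assumes "prime f"
  shows "1 \<le> total_degree f"
proof (rule ccontr)
  assume "\<not> ?thesis"
  then obtain c where c: "f = [:[:c:]:]" using total_degree_0_imp_const[of f] by auto
  then have "c \<noteq> 0" using assms by (metis not_prime_0 pCons_0_0)
  then have "f dvd 1" using c by (auto simp: const_poly_dvd_1 is_unit_const_poly_iff dvd_field_iff)
  then show False using assms not_prime_unit by blast
qed

lemma prod_mset_total_degree:
  assumes "\<And>f. f \<in># M \<Longrightarrow> prime f"
  shows "prod_mset M \<noteq> 0 \<and> size M \<le> total_degree (prod_mset M)"
  using assms
proof (induction M)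
  case (add f M)
  have "prime f" using add.prems by simp
  then have "f \<noteq> 0" by auto
  moreover have "prod_mset M \<noteq> 0" using add by simp
  ultimately have "f \<noteq> 0" "prod_mset M \<noteq> 0" by auto
  then show ?case
    using total_degree_mult[of f "prod_mset M"] total_degree_prime[of f] add by auto
qed simp

lemma card_factors_le:
  assumes "g \<noteq> 0"
  shows "card (prime_factors g) \<le> total_degree g"
proof -
  let ?M = "prime_factorization g"
  have "prod_mset ?M dvd g"
    using assms by (metis associatedD2 dvd_refl prod_mset_prime_factorization_weak)
  then have "size ?M \<le> total_degree g"
    using total_degree_dvd[of "prod_mset ?M" g] assms prod_mset_total_degree[of ?M]
    by (meson in_prime_factors_imp_prime le_trans)
  then show ?thesis
    using mset_set_set_mset_msubset[of ?M] size_mset_mono[of "mset_set (set_mset ?M)" ?M]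
    by simp
qed

lemma factorsD:
  assumes "f \<in> prime_factors g"
  shows "prime f" "f dvd g"
  using assms by auto

lemma eval2_mult: "eval2 (f * g) x y = eval2 f x y * eval2 g x y"
  by (simp add: eval2_def)

lemma eval2_prod_mset: "eval2 (prod_mset M) x y = prod_mset (image_mset (\<lambda>f. eval2 f x y) M)"
  by (induction M) (auto simp: eval2_mult, simp add: eval2_def)

lemma zero_set_dvd: "f dvd g \<Longrightarrow> zero_set f \<subseteq> zero_set g"
  by (auto simp: zero_set_def eval2_mult elim!: dvdE)

text \<open>
Passing from a curve to its prime components loses no point and gains none.
\<close>

lemma zero_set_factors:
  assumes "g \<noteq> 0"
  shows "zero_set g = (\<Union>f\<in>prime_factors g. zero_set f)"
proof
  have "g dvd prod_mset (prime_factorization g)"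
    using assms by (metis associatedD1 dvd_refl prod_mset_prime_factorization_weak)
  then show "zero_set g \<subseteq> (\<Union>f\<in>prime_factors g. zero_set f)"
    using zero_set_dvd by (fastforce simp: zero_set_def eval2_prod_mset prod_mset_zero_iff)
  show "(\<Union>f\<in>prime_factors g. zero_set f) \<subseteq> zero_set g"
    using zero_set_dvd factorsD(2) by blast
qed

text \<open>
The restriction of \<open>g\<close> to a vertical line, as a polynomial in \<open>y\<close>.
\<close>

definition slice :: "real poly poly \<Rightarrow> real \<Rightarrow> real poly" where
  "slice g x = map_poly (\<lambda>c. poly c x) g"

lemma coeff_slice: "coeff (slice g x) j = poly (coeff g j) x"
  by (simp add: slice_def coeff_map_poly)

lemma degree_slice_le: "degree (slice g x) \<le> degree g"
  by (simp add: slice_def degree_map_poly_le)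

lemma poly_eq_sum_less:
  fixes p :: "real poly"
  assumes "degree p < n"
  shows "poly p y = (\<Sum>j<n. coeff p j * y ^ j)"
  unfolding poly_altdef using assms
  by (intro sum.mono_neutral_left) (auto simp: coeff_eq_0)

lemma eval2_slice: "eval2 g x y = poly (slice g x) y"
proof -
  have "poly (slice g x) y = (\<Sum>j<Suc (degree g). coeff (slice g x) j * y ^ j)"
    using degree_slice_le[of g x] by (intro poly_eq_sum_less) simp
  then show ?thesis
    unfolding eval2_eq_sum lessThan_Suc_atMost by (simp add: coeff_slice poly_altdef sum_distrib_right)
qed

lemma slice_pderiv: "slice (pderiv g) x = pderiv (slice g x)"
  by (rule poly_eqI) (simp add: coeff_slice coeff_pderiv poly_mult poly_of_nat flip: of_nat_Suc)

lemma eval2_eq_sum_less: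
  assumes "degree g < n"
  shows "eval2 g x y = (\<Sum>j<n. poly (coeff g j) x * y ^ j)"
  using poly_eq_sum_less[of "slice g x" n y] degree_slice_le[of g x] assms
  by (simp add: eval2_slice coeff_slice)

text \<open>
At a common zero \<open>(x, y)\<close> the Sylvester matrix, evaluated at \<open>x\<close>, annihilates the nonzero vector of the powers
\<open>y\<^sup>d\<^sup>-\<^sup>1, \<dots>, y, 1\<close>: each row lists the coefficients of the product of \<open>f\<close> or \<open>g\<close> with a power of \<open>y\<close>.
Leading coefficients may vanish at \<open>x\<close>.
\<close>

lemma resultant_common_zero:
  assumes 0: "eval2 f x y = 0" "eval2 g x y = 0" and deg: "0 < degree f + degree g"
  shows "poly (resultant f g) x = 0"
proof -
  define m where "m = degree f"
  define n where "n = degree g"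
  let ?S = "sylvester_mat f g"
  let ?T = "map_mat (\<lambda>p. poly p x) ?S"
  let ?v = "vec (m + n) (\<lambda>j. y ^ (m + n - 1 - j))"
  have T: "?T \<in> carrier_mat (m + n) (m + n)"
    using sylvester_carrier_mat[of f g] by (simp add: m_def n_def)
  have row: "(\<Sum>j<m + n. poly (coeff (monom 1 (e - i) * q) (m + n - j)) x * y ^ (m + n - 1 - j)) = 0"
    if q: "eval2 q x y = 0" "i < e" "e + degree q \<le> m + n" for q e i
  proof -
    \<comment> \<open>The index shift between columns and powers of \<open>y\<close> costs one factor \<open>y\<close>.\<close>
    let ?Q = "monom 1 (e - 1 - i) * q"
    have deg: "degree ?Q < m + n"
      using q by (intro le_less_trans[OF degree_mult_le]) (auto simp: degree_monom_eq)
    have "(\<Sum>j<m + n. poly (coeff (monom 1 (e - i) * q) (m + n - j)) x * y ^ (m + n - 1 - j))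
        = (\<Sum>j<m + n. poly (coeff (monom 1 (e - i) * q) (Suc j)) x * y ^ j)"
      by (subst sum.nat_diff_reindex[symmetric]) (intro sum.cong, auto simp: Suc_diff_Suc)
    also have "\<dots> = (\<Sum>j<m + n. poly (coeff ?Q j) x * y ^ j)"
      using q(2) by (intro sum.cong refl) (auto simp: coeff_monom_mult Suc_diff_le)
    also have "\<dots> = eval2 ?Q x y" by (rule eval2_eq_sum_less[OF deg, symmetric])
    also have "\<dots> = 0" by (simp add: eval2_mult q)
    finally show ?thesis .
  qed
  have "?T *\<^sub>v ?v = 0\<^sub>v (m + n)"
  proof (rule eq_vecI)
    fix i assume i: "i < dim_vec (0\<^sub>v (m + n))"
    then have i: "i < m + n" by simp
    have "(?T *\<^sub>v ?v) $ i = (\<Sum>j<m + n. poly (?S $$ (i, j)) x * y ^ (m + n - 1 - j))"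
      using i by (simp add: scalar_prod_def m_def n_def atLeast0LessThan)
    also have "\<dots> = 0"
    proof (cases "i < n")
      case True
      then have "(\<Sum>j<m + n. poly (?S $$ (i, j)) x * y ^ (m + n - 1 - j)) =
        (\<Sum>j<m + n. poly (coeff (monom 1 (n - i) * f) (m + n - j)) x * y ^ (m + n - 1 - j))"
        using i by (intro sum.cong refl) (auto simp: sylvester_index_mat2 m_def n_def)
      then show ?thesis using row[of f i n] 0 True by (simp add: m_def)
    next
      case False
      then have "(\<Sum>j<m + n. poly (?S $$ (i, j)) x * y ^ (m + n - 1 - j)) =
        (\<Sum>j<m + n. poly (coeff (monom 1 (m + n - i) * g) (m + n - j)) x * y ^ (m + n - 1 - j))"
        using i by (intro sum.cong refl) (auto simp: sylvester_index_mat2 m_def n_def)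
      then show ?thesis using row[of g "i - n" m] 0 False i by (simp add: n_def)
    qed
    finally show "(?T *\<^sub>v ?v) $ i = 0\<^sub>v (m + n) $ i" using i by simp
  qed (simp add: m_def n_def)
  moreover have "?v \<noteq> 0\<^sub>v (m + n)"
  proof
    assume "?v = 0\<^sub>v (m + n)"
    then have "?v $ (m + n - 1) = 0\<^sub>v (m + n) $ (m + n - 1)" by simp
    then show False using deg by (simp add: m_def n_def)
  qed
  ultimately have "det ?T = 0"
    using det_0_iff_vec_prod_zero_field[OF T] by (meson vec_carrier)
  then show ?thesis using comm_ring_hom.hom_det[OF poly_hom.comm_ring_hom_axioms, of x ?S]
    by (simp add: resultant_def)
qed

lemma degree_resultant_le:
  assumes "total_degree f \<le> b" "total_degree g \<le> b"
  shows "degree (resultant f g) \<le> 2 * b\<^sup>2"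
proof -
  have "degree (resultant f g) \<le> b * (degree f + degree g)"
    unfolding resultant_def
  proof (rule degree_det_le)
    fix i j assume ij: "i < degree f + degree g" "j < degree f + degree g"
    have "degree (coeff f l) \<le> b" "degree (coeff g l) \<le> b" for l
      using degree_coeff_le_total_degree assms le_trans by blast+
    then show "degree (sylvester_mat f g $$ (i, j)) \<le> b"
      using ij by (auto simp: sylvester_index_mat)
  qed auto
  also have "\<dots> \<le> b * (b + b)"
    using degree_le_total_degree[of f] degree_le_total_degree[of g] assms by (intro mult_left_mono) auto
  finally show ?thesis by (simp add: power2_eq_square algebra_simps)
qed

text \<open>
Distinct primes are coprime, so that their resultant does not vanish identically.
\<close>

lemma common_zeros_primes:
  assumes "prime f" "prime g" "f \<noteq> g" "0 < degree f" "total_degree f \<le> b" "total_degree g \<le> b"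
  shows "finite {x. \<exists>y. eval2 f x y = 0 \<and> eval2 g x y = 0} \<and>
    card {x. \<exists>y. eval2 f x y = 0 \<and> eval2 g x y = 0} \<le> 2 * b\<^sup>2"
proof -
  have "coprime f g" using primes_coprime assms by blast
  then have "resultant f g \<noteq> 0" by (simp add: resultant_0_gcd coprime_iff_gcd_eq_1)
  then have "finite {x. poly (resultant f g) x = 0}" "card {x. poly (resultant f g) x = 0} \<le> 2 * b\<^sup>2"
    using card_poly_roots_bound[of "resultant f g"] degree_resultant_le[OF assms(5,6)] poly_roots_finite
    by auto
  moreover have "{x. \<exists>y. eval2 f x y = 0 \<and> eval2 g x y = 0} \<subseteq> {x. poly (resultant f g) x = 0}"
    using resultant_common_zero assms by auto
  ultimately show ?thesis by (meson finite_subset card_mono le_trans)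
qed

text \<open>
The abscissas over which a root escapes to infinity or a multiple root appears.
\<close>

definition crit :: "real poly poly \<Rightarrow> real set" where
  "crit f = {x. poly (lead_coeff f * resultant f (pderiv f)) x = 0}"

text \<open>
A prime cannot share a factor with its derivative, which is nonzero and of smaller degree in \<open>y\<close>.
\<close>

lemma resultant_pderiv_nonzero:
  fixes f :: "real poly poly"
  assumes "prime f" "0 < degree f"
  shows "resultant f (pderiv f) \<noteq> 0"
proof
  assume "resultant f (pderiv f) = 0"
  then have deg: "degree (gcd f (pderiv f)) \<noteq> 0" by (simp add: resultant_0_gcd)
  have "\<not> gcd f (pderiv f) dvd 1" using deg by (auto simp: poly_dvd_1)
  moreover have "gcd f (pderiv f) dvd f" by simp
  ultimately have "f dvd gcd f (pderiv f)"
    using assms(1) by (meson irreducibleD' prime_elem_imp_irreducible prime_imp_prime_elem)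
  then have "f dvd pderiv f" by simp
  moreover have "pderiv f \<noteq> 0" using assms(2) by (simp add: pderiv_eq_0_iff)
  ultimately have "degree f \<le> degree (pderiv f)" by (rule dvd_imp_degree_le)
  then show False using assms(2) by (simp add: degree_pderiv)
qed

lemma total_degree_pderiv: "total_degree (pderiv f) \<le> total_degree f"
  unfolding total_degree_le_iff
proof (intro allI impI)
  fix i j assume "coeff (coeff (pderiv f) j) i \<noteq> 0"
  then have "coeff (coeff f (Suc j)) i \<noteq> 0"
    by (auto simp: coeff_pderiv of_nat_poly simp del: of_nat_Suc)
  then show "i + j \<le> total_degree f" using total_degree_ge by fastforce
qed

lemma crit_bound:
  assumes "prime f" "0 < degree f" "total_degree f \<le> b"
  shows "finite (crit f) \<and> card (crit f) \<le> b + 2 * b\<^sup>2"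
proof -
  let ?p = "lead_coeff f * resultant f (pderiv f)"
  have nz: "?p \<noteq> 0" using assms resultant_pderiv_nonzero[OF assms(1,2)] by auto
  have "degree ?p \<le> b + 2 * b\<^sup>2"
    using degree_coeff_le_total_degree[of f "degree f"] assms(3) total_degree_pderiv[of f]
    by (intro order_trans[OF degree_mult_le] add_mono degree_resultant_le) auto
  then show ?thesis
    using card_poly_roots_bound[OF nz] poly_roots_finite[OF nz] unfolding crit_def by auto
qed

lemma not_crit:
  assumes "x \<notin> crit f" "0 < degree f"
  shows "poly (lead_coeff f) x \<noteq> 0" "eval2 f x y = 0 \<Longrightarrow> eval2 (pderiv f) x y \<noteq> 0"
  using assms resultant_common_zero[of f x y "pderiv f"] by (auto simp: crit_def)

text \<open>
A curve that contains a whole vertical line has the equation of that line as a factor.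
\<close>

lemma slice_nonzero:
  assumes "prime f" "0 < degree f"
  shows "slice f x \<noteq> 0"
proof
  assume "slice f x = 0"
  then have "poly (coeff f j) x = 0" for j by (metis coeff_slice coeff_0)
  then have "[:- x, 1:] dvd coeff f j" for j by (simp add: poly_eq_0_iff_dvd)
  then have dvd: "[:[:- x, 1:]:] dvd f" by (simp add: const_poly_dvd_iff)
  then obtain g where g: "f = [:[:- x, 1:]:] * g" by (elim dvdE)
  have "irreducible f" using assms by (simp add: prime_elem_imp_irreducible)
  then have "[:[:- x, 1:]:] dvd 1 \<or> g dvd 1" using g irreducibleD by blast
  then show False
  proof
    assume "[:[:- x, 1:]:] dvd (1 :: real poly poly)"
    then show False by (simp add: is_unit_const_poly_iff)
  next
    assume "g dvd 1"
    then have "degree g = 0" by (auto simp: poly_dvd_1)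
    then show False using g assms(2) degree_mult_le[of "[:[:- x, 1:]:]" g] by simp
  qed
qed

lemma card_slice_roots:
  assumes "prime f" "0 < degree f"
  shows "finite {y. eval2 f x y = 0} \<and> card {y. eval2 f x y = 0} \<le> degree f"
  using card_poly_roots_bound[OF slice_nonzero[OF assms]] poly_roots_finite[OF slice_nonzero[OF assms]]
    degree_slice_le[of f x] by (auto simp: eval2_slice intro: le_trans)

lemma vertical_prime:
  assumes "prime f" "degree f = 0" "eval2 f x y = 0"
  shows "f = normalize [:[:- x, 1:]:]"
proof -
  obtain a where a: "f = [:a:]" using degree_eq_zeroE[OF assms(2)] by auto
  then have "poly a x = 0" using assms(3) by (simp add: eval2_def)
  then have "[:- x, 1:] dvd a" by (simp add: poly_eq_0_iff_dvd)
  then have dvd: "[:[:- x, 1:]:] dvd f" using a by (simp add: const_poly_dvd_const_poly_iff)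
  have "\<not> [:[:- x, 1:]:] dvd (1 :: real poly poly)" by (simp add: is_unit_const_poly_iff)
  moreover have "irreducible f" using assms by (simp add: prime_elem_imp_irreducible)
  ultimately have "f dvd [:[:- x, 1:]:]" using dvd irreducibleD' by blast
  then have "normalize f = normalize [:[:- x, 1:]:]" using dvd by (intro associatedI)
  then show ?thesis using assms(1) by simp
qed

section \<open>Continuity of the real roots along a curve without critical values\<close>

definition fiber :: "real poly poly \<Rightarrow> real \<Rightarrow> real set" where
  "fiber f x = {y. eval2 f x y = 0}"

text \<open>
The \<open>i\<close>-th smallest root over \<open>x\<close>, counted from \<open>0\<close>. It is meaningful only if there are more than \<open>i\<close> roots.
\<close>

definition branch :: "real poly poly \<Rightarrow> nat \<Rightarrow> real \<Rightarrow> real" where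
  "branch f i x = sorted_list_of_set (fiber f x) ! i"

lemma continuous_on_eval2: "continuous_on S (\<lambda>p. eval2 f (fst p) (snd p))"
  unfolding eval2_eq_sum by (intro continuous_intros)

lemma isCont_eval2: "isCont (\<lambda>p. eval2 f (fst p) (snd p)) p"
  using continuous_on_eval2[of UNIV f] by (simp add: continuous_on_eq_continuous_at del: split_paired_All)

lemma isCont_eval2_fst: "isCont (\<lambda>x. eval2 f x y) x"
  unfolding eval2_eq_sum by (intro continuous_intros)

lemma poly_root_bound:
  fixes p :: "real poly"
  assumes "poly p z = 0" "degree p = d" "0 < d"
  shows "\<bar>z\<bar> \<le> 1 + (\<Sum>j<d. \<bar>coeff p j\<bar>) / \<bar>coeff p d\<bar>"
proof (cases "\<bar>z\<bar> \<le> 1")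
  case False
  have lc: "coeff p d \<noteq> 0" using assms by (metis degree_0 leading_coeff_0_iff less_numeral_extra(3))
  have "coeff p d * z ^ d = - (\<Sum>j<d. coeff p j * z ^ j)"
    using poly_eq_sum_less[of p "Suc d" z] assms by simp
  then have "\<bar>coeff p d\<bar> * \<bar>z\<bar> ^ d = \<bar>\<Sum>j<d. coeff p j * z ^ j\<bar>"
    by (metis abs_minus_cancel abs_mult power_abs)
  also have "\<dots> \<le> (\<Sum>j<d. \<bar>coeff p j\<bar> * \<bar>z\<bar> ^ (d - 1))"
    using False by (intro order_trans[OF sum_abs] sum_mono)
      (auto simp: abs_mult power_abs intro!: mult_left_mono power_increasing)
  also have "\<dots> = (\<Sum>j<d. \<bar>coeff p j\<bar>) * \<bar>z\<bar> ^ (d - 1)"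
    by (simp add: sum_distrib_right)
  also have "\<bar>z\<bar> ^ d = \<bar>z\<bar> * \<bar>z\<bar> ^ (d - 1)" using assms by (simp add: power_eq_if)
  finally have "(\<bar>coeff p d\<bar> * \<bar>z\<bar>) * \<bar>z\<bar> ^ (d - 1) \<le> (\<Sum>j<d. \<bar>coeff p j\<bar>) * \<bar>z\<bar> ^ (d - 1)"
    by (simp add: mult.assoc)
  then have "\<bar>coeff p d\<bar> * \<bar>z\<bar> \<le> (\<Sum>j<d. \<bar>coeff p j\<bar>)"
    by (rule mult_right_le_imp_le) (use False in \<open>auto intro!: zero_less_power\<close>)
  then show ?thesis using lc by (simp add: field_simps)
qed (simp add: sum_nonneg add_increasing2)

text \<open>
Roots stay bounded as long as the leading coefficient stays away from \<open>0\<close>.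
\<close>

lemma compact_zeros:
  assumes "0 < degree f" "\<And>x. x \<in> {u..v} \<Longrightarrow> poly (lead_coeff f) x \<noteq> 0"
  shows "compact {(x, y). x \<in> {u..v} \<and> eval2 f x y = 0}"
proof -
  let ?d = "degree f"
  let ?b = "\<lambda>x. 1 + (\<Sum>j<?d. \<bar>poly (coeff f j) x\<bar>) / \<bar>poly (coeff f ?d) x\<bar>"
  have "continuous_on {u..v} ?b"
    using assms by (intro continuous_intros) auto
  then have "compact (?b ` {u..v})" by (intro compact_continuous_image) auto
  then obtain K where K: "\<And>x. x \<in> {u..v} \<Longrightarrow> \<bar>?b x\<bar> \<le> K"
    using compact_imp_bounded[of "?b ` {u..v}"] unfolding bounded_real by blast
  have "y \<in> {- K..K}" if "x \<in> {u..v}" "eval2 f x y = 0" for x y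
  proof -
    have "degree (slice f x) = ?d"
      using degree_slice_le[of f x] le_degree[of "slice f x" ?d] assms(2)[OF that(1)]
      by (simp add: coeff_slice)
    then have "\<bar>y\<bar> \<le> ?b x"
      using poly_root_bound[of "slice f x" y ?d] that assms(1) by (simp add: eval2_slice coeff_slice)
    then show ?thesis using K[OF that(1)] by auto
  qed
  then have sub: "{(x, y). x \<in> {u..v} \<and> eval2 f x y = 0} = ({u..v} \<times> {- K..K}) \<inter> {p. eval2 f (fst p) (snd p) = 0}"
    by auto
  show ?thesis unfolding sub
    by (intro compact_Int_closed compact_Times compact_Icc closed_Collect_eq continuous_on_eval2 continuous_on_const)
qed

text \<open>
The zeros outside \<open>W\<close> form a compact set, whose projection to the \<open>x\<close>-axis is closed and misses \<open>x0\<close>.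
\<close>

lemma roots_stay_near:
  assumes "0 < degree f" "\<And>x. x \<in> {u..v} \<Longrightarrow> poly (lead_coeff f) x \<noteq> 0"
    and x0: "x0 \<in> {u..v}" and W: "open W" "fiber f x0 \<subseteq> W"
  shows "eventually (\<lambda>x. fiber f x \<subseteq> W) (at x0 within {u..v})"
proof -
  let ?K = "{(x, y). x \<in> {u..v} \<and> eval2 f x y = 0} \<inter> (UNIV \<times> - W)"
  have "compact ?K"
    using W by (intro compact_Int_closed compact_zeros assms closed_Times) auto
  then have "compact (fst ` ?K)" by (intro compact_continuous_image continuous_intros)
  then have "open (- (fst ` ?K))" by (simp add: compact_imp_closed open_Compl)
  moreover have "x0 \<in> - (fst ` ?K)" using W by (auto simp: fiber_def)
  ultimately have "eventually (\<lambda>x. x \<in> - (fst ` ?K)) (at x0 within {u..v})"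
    by (intro eventually_at_topological[THEN iffD2]) blast
  moreover have "eventually (\<lambda>x. x \<in> {u..v}) (at x0 within {u..v})"
    by (auto simp: eventually_at_filter)
  ultimately show ?thesis
    by eventually_elim (force simp: fiber_def)
qed

text \<open>
At a simple root the sign changes, and a sign change survives small perturbations.
\<close>

lemma simple_root_persists:
  assumes "eval2 f x0 y0 = 0" "eval2 (pderiv f) x0 y0 \<noteq> 0" "0 < \<delta>"
  shows "eventually (\<lambda>x. \<exists>y. y \<in> fiber f x \<and> \<bar>y - y0\<bar> < \<delta>) (at x0 within S)"
proof -
  let ?p = "slice f x0"
  have der: "DERIV (poly ?p) y0 :> eval2 (pderiv f) x0 y0"
    by (simp add: eval2_slice slice_pderiv poly_DERIV)
  have p0: "poly ?p y0 = 0" using assms by (simp add: eval2_slice)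
  have "\<exists>y1 y2. y0 - \<delta> < y1 \<and> y1 < y0 \<and> y0 < y2 \<and> y2 < y0 + \<delta> \<and> poly ?p y1 * poly ?p y2 < 0"
  proof (cases "0 < eval2 (pderiv f) x0 y0")
    case True
    obtain d1 d2 where d: "0 < d1" "\<And>h. 0 < h \<Longrightarrow> h < d1 \<Longrightarrow> poly ?p y0 < poly ?p (y0 + h)"
      "0 < d2" "\<And>h. 0 < h \<Longrightarrow> h < d2 \<Longrightarrow> poly ?p (y0 - h) < poly ?p y0"
      using DERIV_pos_inc_right[OF der True] DERIV_pos_inc_left[OF der True] by auto
    define e where "e = min \<delta> (min d1 d2) / 2"
    have "0 < e" "e < \<delta>" "e < d1" "e < d2" using d assms(3) by (auto simp: e_def)
    then show ?thesis using d(2)[of e] d(4)[of e] p0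
      by (intro exI[of _ "y0 - e"] exI[of _ "y0 + e"]) (auto simp: mult_neg_pos)
  next
    case False
    then have neg: "eval2 (pderiv f) x0 y0 < 0" using assms by simp
    obtain d1 d2 where d: "0 < d1" "\<And>h. 0 < h \<Longrightarrow> h < d1 \<Longrightarrow> poly ?p (y0 + h) < poly ?p y0"
      "0 < d2" "\<And>h. 0 < h \<Longrightarrow> h < d2 \<Longrightarrow> poly ?p y0 < poly ?p (y0 - h)"
      using DERIV_neg_dec_right[OF der neg] DERIV_neg_dec_left[OF der neg] by auto
    define e where "e = min \<delta> (min d1 d2) / 2"
    have "0 < e" "e < \<delta>" "e < d1" "e < d2" using d assms(3) by (auto simp: e_def)
    then show ?thesis using d(2)[of e] d(4)[of e] p0
      by (intro exI[of _ "y0 - e"] exI[of _ "y0 + e"]) (auto simp: mult_pos_neg)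
  qed
  then obtain y1 y2 where y: "y0 - \<delta> < y1" "y1 < y2" "y2 < y0 + \<delta>" "eval2 f x0 y1 * eval2 f x0 y2 < 0"
    unfolding eval2_slice by (meson less_trans)
  have "isCont (\<lambda>x. eval2 f x y1 * eval2 f x y2) x0"
    by (intro continuous_intros isCont_eval2_fst)
  then have "eventually (\<lambda>x. eval2 f x y1 * eval2 f x y2 < 0) (at x0)"
    using y(4) by (auto simp: isCont_def intro: order_tendstoD)
  then have "eventually (\<lambda>x. eval2 f x y1 * eval2 f x y2 < 0) (at x0 within S)"
    by (rule filter_leD[OF at_le, rotated]) auto
  then show ?thesis
  proof eventually_elim
    case (elim x)
    then obtain z where "y1 < z" "z < y2" "poly (slice f x) z = 0"
      using poly_IVT[of y1 y2 "slice f x"] y by (auto simp: eval2_slice)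
    then show ?case using y by (intro exI[of _ z]) (auto simp: fiber_def eval2_slice)
  qed
qed

text \<open>
Between two roots there is a zero of the derivative, and near a simple root there is none.
\<close>

lemma simple_root_isolated:
  assumes "eval2 (pderiv f) x0 y0 \<noteq> 0"
  obtains d where "0 < d" "eventually (\<lambda>x. \<forall>y\<in>fiber f x. \<forall>z\<in>fiber f x.
      \<bar>y - y0\<bar> < d \<longrightarrow> \<bar>z - y0\<bar> < d \<longrightarrow> y = z) (at x0 within S)"
proof -
  have "((\<lambda>p. eval2 (pderiv f) (fst p) (snd p)) \<longlongrightarrow> eval2 (pderiv f) (fst (x0, y0)) (snd (x0, y0))) (nhds (x0, y0))"
    using isCont_eval2[where f = "pderiv f" and p = "(x0, y0)"]
      tendsto_at_iff_tendsto_nhds[of "\<lambda>p. eval2 (pderiv f) (fst p) (snd p)" "(x0, y0)"]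
    by (simp only: isCont_def)
  from tendsto_imp_eventually_ne[OF this, of 0] assms
  have "eventually (\<lambda>p. eval2 (pderiv f) (fst p) (snd p) \<noteq> 0) (nhds (x0, y0))"
    by simp
  then obtain e where e: "0 < e" "\<And>p. dist p (x0, y0) < e \<Longrightarrow> eval2 (pderiv f) (fst p) (snd p) \<noteq> 0"
    by (auto simp: eventually_nhds_metric)
  have ne: "eval2 (pderiv f) x y \<noteq> 0" if "\<bar>x - x0\<bar> < e / 2" "\<bar>y - y0\<bar> < e / 2" for x y
  proof -
    have "dist (x, y) (x0, y0) \<le> \<bar>x - x0\<bar> + \<bar>y - y0\<bar>"
      by (simp add: dist_prod_def dist_real_def sqrt_sum_squares_le_sum_abs)
    then show ?thesis using e(2)[of "(x, y)"] that by auto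
  qed
  have one: "\<not> y < z" if "\<bar>x - x0\<bar> < e / 2" "y \<in> fiber f x" "z \<in> fiber f x" "\<bar>y - y0\<bar> < e / 2" "\<bar>z - y0\<bar> < e / 2" for x y z
  proof
    assume "y < z"
    then obtain w where w: "y < w" "w < z" "poly (slice f x) z - poly (slice f x) y = (z - y) * poly (pderiv (slice f x)) w"
      using poly_MVT by blast
    then have "eval2 (pderiv f) x w = 0"
      using that \<open>y < z\<close> by (auto simp: fiber_def eval2_slice slice_pderiv)
    moreover have "\<bar>w - y0\<bar> < e / 2"
      using w(1,2) that(4,5) unfolding abs_less_iff by linarith
    ultimately show False using ne that(1) by blast
  qed
  show ?thesis
  proof (rule that[of "e / 2"])
    have "eventually (\<lambda>x. \<bar>x - x0\<bar> < e / 2) (at x0 within S)"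
      unfolding eventually_at using e(1) by (intro exI[of _ "e / 2"]) (auto simp: dist_real_def)
    then show "eventually (\<lambda>x. \<forall>y\<in>fiber f x. \<forall>z\<in>fiber f x.
      \<bar>y - y0\<bar> < e / 2 \<longrightarrow> \<bar>z - y0\<bar> < e / 2 \<longrightarrow> y = z) (at x0 within S)"
      by eventually_elim (meson one linorder_neqE_linordered_idom)
  qed (use e in auto)
qed

lemma sorted_list_of_fiber:
  assumes "finite (fiber f x)" "i < card (fiber f x)"
  shows "branch f i x \<in> fiber f x" "card {y \<in> fiber f x. y < branch f i x} = i"
proof -
  let ?l = "sorted_list_of_set (fiber f x)"
  have l: "length ?l = card (fiber f x)" "set ?l = fiber f x" "sorted_wrt (<) ?l"
    using assms by auto
  then show "branch f i x \<in> fiber f x" unfolding branch_def using assms nth_mem[of i ?l] by auto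
  have "{y \<in> fiber f x. y < ?l ! i} = (!) ?l ` {..<i}"
  proof (intro equalityI subsetI)
    fix y assume "y \<in> {y \<in> fiber f x. y < ?l ! i}"
    then obtain j where j: "j < length ?l" "y = ?l ! j" "?l ! j < ?l ! i"
      using l(2) by (metis (mono_tags, lifting) in_set_conv_nth mem_Collect_eq)
    then have "\<not> i < j" "i \<noteq> j" using sorted_wrt_nth_less[OF l(3), of i j] by auto
    then have "j < i" by simp
    then show "y \<in> (!) ?l ` {..<i}" using j by auto
  next
    fix y assume "y \<in> (!) ?l ` {..<i}"
    then obtain j where j: "j < i" "y = ?l ! j" by blast
    then have "j < length ?l" "i < length ?l" using assms l(1) by simp_all
    then have "y \<in> fiber f x" "y < ?l ! i"
      using j l(2) nth_mem[of j ?l] sorted_wrt_nth_less[OF l(3), of j i] by auto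
    then show "y \<in> {y \<in> fiber f x. y < ?l ! i}" by simp
  qed
  moreover have "inj_on ((!) ?l) {..<i}"
    using assms l by (intro inj_on_nth) auto
  ultimately show "card {y \<in> fiber f x. y < branch f i x} = i"
    by (simp add: branch_def card_image)
qed

lemma branch_rank:
  assumes "finite (fiber f x)" "y \<in> fiber f x"
  shows "card {z \<in> fiber f x. z < y} < card (fiber f x)" "branch f (card {z \<in> fiber f x. z < y}) x = y"
proof -
  let ?r = "\<lambda>y. card {z \<in> fiber f x. z < y}"
  show lt: "?r y < card (fiber f x)" using assms by (intro psubset_card_mono) auto
  have mono: "?r a < ?r b" if "a \<in> fiber f x" "a < b" for a b
    using that assms by (intro psubset_card_mono) auto
  have "?r (branch f (?r y) x) = ?r y" "branch f (?r y) x \<in> fiber f x"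
    using sorted_list_of_fiber[OF assms(1) lt] by auto
  then show "branch f (?r y) x = y"
    using mono[of y "branch f (?r y) x"] mono[of "branch f (?r y) x" y] assms(2)
      linorder_less_linear[of y "branch f (?r y) x"] by auto
qed

text \<open>
By the three preceding lemmas, exactly one root over \<open>x\<close> lies near each root over \<open>x0\<close>, and there are no
others. This correspondence preserves the order, hence the numbering of the roots.
\<close>

lemma branches_locally_stable:
  assumes f: "0 < degree f" and nc: "{u..v} \<inter> crit f = {}" and x0: "x0 \<in> {u..v}"
    and fin: "finite (fiber f x0)" and e: "0 < e"
  shows "eventually (\<lambda>x. card (fiber f x) = card (fiber f x0) \<and>
      (\<forall>i<card (fiber f x0). \<bar>branch f i x - branch f i x0\<bar> < e)) (at x0 within {u..v})"
proof -
  let ?Z = "fiber f x0" and ?F = "at x0 within {u..v}"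
  define ys where "ys = sorted_list_of_set ?Z"
  define n where "n = card ?Z"
  have ys: "length ys = n" "set ys = ?Z" "sorted_wrt (<) ys"
    using fin by (auto simp: ys_def n_def)
  have lead: "poly (lead_coeff f) x \<noteq> 0" if "x \<in> {u..v}" for x
    using not_crit(1)[OF _ f] nc that by blast
  have simple: "eval2 (pderiv f) x0 y \<noteq> 0" if "y \<in> ?Z" for y
    using not_crit(2)[OF _ f, of x0 y] nc x0 that unfolding fiber_def by blast
  let ?sep = "\<lambda>y d x. \<forall>w\<in>fiber f x. \<forall>z\<in>fiber f x. \<bar>w - y\<bar> < d \<longrightarrow> \<bar>z - y\<bar> < d \<longrightarrow> w = z"
  have "\<forall>y\<in>?Z. \<exists>d. 0 < d \<and> eventually (?sep y d) ?F"
  proof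
    fix y assume "y \<in> ?Z"
    then obtain d where "0 < d" "eventually (?sep y d) ?F"
      by (rule simple_root_isolated[OF simple])
    then show "\<exists>d. 0 < d \<and> eventually (?sep y d) ?F" by (intro exI[of _ d] conjI)
  qed
  then have "\<exists>D. \<forall>y\<in>?Z. 0 < D y \<and> eventually (?sep y (D y)) ?F" by (rule bchoice)
  then obtain D where D0: "\<forall>y\<in>?Z. 0 < D y \<and> eventually (?sep y (D y)) ?F" by (rule exE)
  have D: "0 < D y" "eventually (?sep y (D y)) ?F" if "y \<in> ?Z" for y
    using bspec[OF D0 that] by simp_all
  \<comment> \<open>Small enough for the intervals around the roots to be disjoint, to contain one root each, and to have length below the required accuracy.\<close>
  let ?gaps = "(\<lambda>(y, z). \<bar>y - z\<bar> / 2) ` {(y, z) \<in> ?Z \<times> ?Z. y \<noteq> z}"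
  let ?M = "insert e (D ` ?Z \<union> ?gaps)"
  define \<delta> where "\<delta> = Min ?M"
  have "finite {(y, z) \<in> ?Z \<times> ?Z. y \<noteq> z}"
    by (rule finite_subset[of _ "?Z \<times> ?Z"]) (use fin in auto)
  then have finM: "finite ?M" using fin by auto
  have "0 < \<delta>" unfolding \<delta>_def using finM D(1) e by (subst Min_gr_iff) auto
  have \<delta>: "\<delta> \<le> e" "\<And>y. y \<in> ?Z \<Longrightarrow> \<delta> \<le> D y"
    "\<And>y z. y \<in> ?Z \<Longrightarrow> z \<in> ?Z \<Longrightarrow> y \<noteq> z \<Longrightarrow> \<delta> \<le> \<bar>y - z\<bar> / 2"
  proof -
    have M: "\<delta> \<le> w" if "w \<in> ?M" for w
      unfolding \<delta>_def by (rule Min_le[OF finM that])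
    show "\<delta> \<le> e" "\<And>y. y \<in> ?Z \<Longrightarrow> \<delta> \<le> D y" by (intro M; blast)+
    fix y z assume "y \<in> ?Z" "z \<in> ?Z" "y \<noteq> z"
    then have "\<bar>y - z\<bar> / 2 \<in> ?gaps" by (intro image_eqI[where x = "(y, z)"]) auto
    then show "\<delta> \<le> \<bar>y - z\<bar> / 2" by (intro M) blast
  qed
  have 1: "eventually (\<lambda>x. \<forall>y\<in>?Z. \<exists>z. z \<in> fiber f x \<and> \<bar>z - y\<bar> < \<delta>) ?F"
    using fin simple \<open>0 < \<delta>\<close>
    by (intro eventually_ball_finite ballI simple_root_persists) (auto simp: fiber_def)
  have 2: "eventually (\<lambda>x. \<forall>y\<in>?Z. \<forall>w\<in>fiber f x. \<forall>z\<in>fiber f x.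
      \<bar>w - y\<bar> < D y \<longrightarrow> \<bar>z - y\<bar> < D y \<longrightarrow> w = z) ?F"
    by (intro eventually_ball_finite fin ballI D)
  have 3: "eventually (\<lambda>x. fiber f x \<subseteq> (\<Union>y\<in>?Z. ball y \<delta>)) ?F"
    using \<open>0 < \<delta>\<close> by (intro roots_stay_near f lead x0) auto
  from 1 2 3 show ?thesis
  proof eventually_elim
    case (elim x)
    then obtain g where g: "\<And>y. y \<in> ?Z \<Longrightarrow> g y \<in> fiber f x" "\<And>y. y \<in> ?Z \<Longrightarrow> \<bar>g y - y\<bar> < \<delta>"
      by metis
    have onto: "z \<in> g ` ?Z" if z: "z \<in> fiber f x" for z
    proof -
      obtain y where y: "y \<in> ?Z" "\<bar>z - y\<bar> < \<delta>"
        using elim(3) z by (auto simp: dist_real_def abs_minus_commute)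
      then have "z = g y"
        using elim(2) z g[OF y(1)] \<delta>(2)[OF y(1)] by (meson order_less_le_trans)
      then show ?thesis using y by auto
    qed
    have mono: "g y < g z" if "y \<in> ?Z" "z \<in> ?Z" "y < z" for y z
      using g(2)[OF that(1)] g(2)[OF that(2)] \<delta>(3)[OF that(1,2)] that(3) by auto
    have "g ` ?Z = fiber f x" using g onto by auto
    then have set: "set (map g ys) = fiber f x" using ys by simp
    have "sorted_wrt (<) (map g ys)"
      using ys(2,3) mono by (auto simp: sorted_wrt_map intro: sorted_wrt_mono_rel[of _ "(<)"])
    then have "sorted_list_of_set (fiber f x) = map g ys"
      using set by (metis List.finite_set sorted_list_of_set.strict_sorted_key_list_of_set
          sorted_list_of_set.set_sorted_key_list_of_set strict_sorted_equal)
    moreover have "card (fiber f x) = n"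
      using \<open>sorted_wrt (<) (map g ys)\<close> set ys(1)
      by (metis distinct_card length_map strict_sorted_iff)
    moreover have "\<bar>g (ys ! i) - ys ! i\<bar> < e" if "i < n" for i
      using g(2)[of "ys ! i"] nth_mem[of i ys] ys that \<delta>(1) by auto
    ultimately show ?case
      using ys by (auto simp: branch_def n_def ys_def[symmetric])
  qed
qed

lemma branch_continuous:
  assumes f: "0 < degree f" and nc: "{u..v} \<inter> crit f = {}"
    and fin: "\<And>x. finite (fiber f x)"
    and a: "a \<in> {u..v}" and i: "i < card (fiber f a)"
  shows "continuous_on {u..v} (branch f i)" "\<And>x. x \<in> {u..v} \<Longrightarrow> i < card (fiber f x)"
proof -
  have "card (fiber f x) = card (fiber f a)" if "x \<in> {u..v}" for x
  proof (rule connected_local_const[of "{u..v}" x a "\<lambda>x. card (fiber f x)"])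
    show "\<forall>a\<in>{u..v}. \<forall>\<^sub>F b in at a within {u..v}. card (fiber f a) = card (fiber f b)"
    proof
      fix w assume "w \<in> {u..v}"
      from branches_locally_stable[OF f nc this fin, of 1]
      show "\<forall>\<^sub>F b in at w within {u..v}. card (fiber f w) = card (fiber f b)"
        by (auto elim: eventually_mono)
    qed
  qed (use that a in auto)
  then show lt: "\<And>x. x \<in> {u..v} \<Longrightarrow> i < card (fiber f x)" using i by simp
  show "continuous_on {u..v} (branch f i)"
    unfolding continuous_on_def
  proof
    fix w assume w: "w \<in> {u..v}"
    show "(branch f i \<longlongrightarrow> branch f i w) (at w within {u..v})"
    proof (rule tendstoI)
      fix e :: real assume "0 < e"
      from branches_locally_stable[OF f nc w fin this]
      show "\<forall>\<^sub>F x in at w within {u..v}. dist (branch f i x) (branch f i w) < e"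
        using lt[OF w] by (auto simp: dist_real_def elim: eventually_mono)
    qed
  qed
qed

section \<open>The arcs of a family of curves\<close>

text \<open>
The critical values cut the \<open>x\<close>-axis into open intervals, numbered from left to right.
\<close>

definition slab :: "real poly poly \<Rightarrow> real \<Rightarrow> nat" where
  "slab f x = card {c \<in> crit f. c < x}"

definition rank :: "real poly poly \<Rightarrow> real \<times> real \<Rightarrow> nat" where
  "rank f p = card {y \<in> fiber f (fst p). y < snd p}"

text \<open>
A curve \<open>f\<close>, the number of an interval between critical values, and the number of a root.
\<close>

type_synonym arc = "real poly poly \<times> nat \<times> nat"

definition arc_points :: "(real \<times> real) set \<Rightarrow> arc \<Rightarrow> (real \<times> real) set" where
  "arc_points P = (\<lambda>(f, j, i). {p \<in> P. p \<in> zero_set f \<and> fst p \<notin> crit f \<and> slab f (fst p) = j \<and> rank f p = i})"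

text \<open>
Only the arcs that contain one of the points are kept, and each is cut down to the smallest interval
that carries its points. This makes its domain compact and free of critical values.
\<close>

definition arcs :: "(real \<times> real) set \<Rightarrow> real poly poly set \<Rightarrow> arc set" where
  "arcs P F = {a. fst a \<in> F \<and> arc_points P a \<noteq> {}}"

definition arc_lo :: "(real \<times> real) set \<Rightarrow> arc \<Rightarrow> real" where
  "arc_lo P a = Min (fst ` arc_points P a)"

definition arc_hi :: "(real \<times> real) set \<Rightarrow> arc \<Rightarrow> real" where
  "arc_hi P a = Max (fst ` arc_points P a)"

definition arc_height :: "arc \<Rightarrow> real \<Rightarrow> real" where
  "arc_height = (\<lambda>(f, j, i). branch f i)"

definition on_arc :: "(real \<times> real) set \<Rightarrow> arc \<Rightarrow> real \<times> real \<Rightarrow> bool" where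
  "on_arc P a p \<longleftrightarrow> arc_lo P a \<le> fst p \<and> fst p \<le> arc_hi P a \<and> arc_height a (fst p) = snd p"

lemma mem_zero_set: "p \<in> zero_set f \<longleftrightarrow> snd p \<in> fiber f (fst p)"
  by (cases p) (simp add: zero_set_def fiber_def)

lemma finite_fiber: "prime f \<Longrightarrow> 0 < degree f \<Longrightarrow> finite (fiber f x) \<and> card (fiber f x) \<le> degree f"
  using card_slice_roots[of f x] by (simp add: fiber_def)

context
  fixes P :: "(real \<times> real) set" and F :: "real poly poly set" and b :: nat
  assumes P: "finite P" and F: "finite F"
    and primes: "\<And>f. f \<in> F \<Longrightarrow> prime f" and nonvertical: "\<And>f. f \<in> F \<Longrightarrow> 0 < degree f"
    and deg: "\<And>f. f \<in> F \<Longrightarrow> total_degree f \<le> b"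
begin

lemma finite_crit: "f \<in> F \<Longrightarrow> finite (crit f) \<and> card (crit f) \<le> b + 2 * b\<^sup>2"
  using crit_bound[of f b] primes nonvertical deg by auto

lemma card_fiber: "f \<in> F \<Longrightarrow> finite (fiber f x) \<and> card (fiber f x) \<le> b"
  using finite_fiber[of f x] primes nonvertical deg degree_le_total_degree[of f] by fastforce

lemma card_arcs_le: "finite (arcs P F) \<and> card (arcs P F) \<le> card F * ((b + 2 * b\<^sup>2 + 1) * b)"
proof -
  let ?B = "F \<times> {..b + 2 * b\<^sup>2} \<times> {..<b}"
  have "arcs P F \<subseteq> ?B"
  proof
    fix a assume a: "a \<in> arcs P F"
    obtain f j i where [simp]: "a = (f, j, i)" by (cases a)
    obtain p where p: "f \<in> F" "p \<in> zero_set f" "slab f (fst p) = j" "rank f p = i"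
      using a by (auto simp: arcs_def arc_points_def)
    have "slab f (fst p) \<le> card (crit f)"
      unfolding slab_def using finite_crit[OF p(1)] by (intro card_mono) auto
    moreover have "rank f p < card (fiber f (fst p))"
      unfolding rank_def using branch_rank(1) card_fiber[OF p(1)] p(2) mem_zero_set by blast
    ultimately show "a \<in> ?B" using p finite_crit[OF p(1)] card_fiber[OF p(1), of "fst p"] by auto
  qed
  moreover have "finite ?B" using F by simp
  moreover have "card ?B = card F * ((b + 2 * b\<^sup>2 + 1) * b)" by (simp add: card_cartesian_product)
  ultimately show ?thesis using finite_subset card_mono by metis
qed

text \<open>
The two ends of an arc lie in the same slab, so no critical value is between them.
\<close>

lemma arc_range:
  assumes a: "(f, j, i) \<in> arcs P F" and x: "x \<in> {arc_lo P (f, j, i)..arc_hi P (f, j, i)}"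
  shows "x \<notin> crit f" "slab f x = j"
proof -
  let ?X = "fst ` arc_points P (f, j, i)"
  have fX: "finite ?X" "?X \<noteq> {}" using P a by (auto simp: arc_points_def arcs_def)
  define l u where "l = arc_lo P (f, j, i)" and "u = arc_hi P (f, j, i)"
  have "l \<in> ?X" "u \<in> ?X" using fX by (auto simp: l_def u_def arc_lo_def arc_hi_def)
  then have lu: "l \<notin> crit f" "slab f l = j" "u \<notin> crit f" "slab f u = j"
    by (auto simp: arc_points_def)
  have fin: "finite (crit f)" using a finite_crit[of f] by (auto simp: arcs_def)
  have free: "c \<notin> crit f" if "l \<le> c" "c \<le> u" for c
  proof
    assume c: "c \<in> crit f"
    then have "c \<noteq> l" "c \<noteq> u" using lu by auto
    then have "l < c" "c < u" using that by simp_all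
    have "{c' \<in> crit f. c' < l} \<subseteq> {c' \<in> crit f. c' < u}"
      using \<open>l < c\<close> \<open>c < u\<close> by (intro Collect_mono) auto
    moreover have "c \<in> {c' \<in> crit f. c' < u}" "c \<notin> {c' \<in> crit f. c' < l}"
      using c \<open>l < c\<close> \<open>c < u\<close> by simp_all
    ultimately have "{c' \<in> crit f. c' < l} \<subset> {c' \<in> crit f. c' < u}" by blast
    then have "slab f l < slab f u" unfolding slab_def using fin by (intro psubset_card_mono) auto
    then show False using lu by simp
  qed
  show "x \<notin> crit f" using free x by (simp add: l_def u_def)
  have "c < x \<longleftrightarrow> c < l" if "c \<in> crit f" for c
    using free[of c] x that unfolding l_def[symmetric] u_def[symmetric]
    by (cases "l \<le> c") auto
  then have "{c \<in> crit f. c < x} = {c \<in> crit f. c < l}" by blast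
  then show "slab f x = j" using lu by (simp add: slab_def)
qed

lemma arc_branch:
  assumes a: "(f, j, i) \<in> arcs P F"
  defines "J \<equiv> {arc_lo P (f, j, i)..arc_hi P (f, j, i)}"
  shows "continuous_on J (branch f i)" "\<And>x. x \<in> J \<Longrightarrow> i < card (fiber f x)"
proof -
  have f: "f \<in> F" using a by (simp add: arcs_def)
  obtain p where p: "p \<in> arc_points P (f, j, i)" using a by (auto simp: arcs_def)
  then have "fst p \<in> fst ` arc_points P (f, j, i)" by simp
  moreover have "finite (fst ` arc_points P (f, j, i))" using P by (auto simp: arc_points_def)
  ultimately have pJ: "fst p \<in> J" by (auto simp: J_def arc_lo_def arc_hi_def)
  have i: "i < card (fiber f (fst p))"
    using branch_rank(1)[of f "fst p" "snd p"] card_fiber[OF f] p mem_zero_set[of p f]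
    by (auto simp: arc_points_def rank_def)
  have nc: "J \<inter> crit f = {}" using arc_range(1)[OF a] by (auto simp: J_def)
  show "continuous_on J (branch f i)" "\<And>x. x \<in> J \<Longrightarrow> i < card (fiber f x)"
    using branch_continuous[OF nonvertical[OF f] nc[unfolded J_def] _ pJ[unfolded J_def] i] card_fiber[OF f]
    unfolding J_def by auto
qed

lemma on_arcD:
  assumes a: "(f, j, i) \<in> arcs P F" and p: "on_arc P (f, j, i) p"
  shows "p \<in> zero_set f" "slab f (fst p) = j" "rank f p = i"
proof -
  have f: "f \<in> F" using a by (simp add: arcs_def)
  have x: "fst p \<in> {arc_lo P (f, j, i)..arc_hi P (f, j, i)}" and y: "snd p = branch f i (fst p)"
    using p by (auto simp: on_arc_def arc_height_def)
  show "slab f (fst p) = j" by (rule arc_range(2)[OF a x])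
  show "p \<in> zero_set f" "rank f p = i"
    using sorted_list_of_fiber[of f "fst p" i] card_fiber[OF f] arc_branch(2)[OF a x] y
    by (auto simp: mem_zero_set rank_def)
qed

lemma on_arc_unique:
  assumes "a \<in> arcs P F" "a' \<in> arcs P F" "on_arc P a p" "on_arc P a' p" "fst a = fst a'"
  shows "a = a'"
  using assms on_arcD by (cases a, cases a') (metis fst_conv)

lemma on_some_arc:
  assumes f: "f \<in> F" and p: "p \<in> P" "p \<in> zero_set f" "fst p \<notin> crit f"
  obtains a where "a \<in> arcs P F" "fst a = f" "on_arc P a p"
proof
  let ?a = "(f, slab f (fst p), rank f p)"
  have mem: "p \<in> arc_points P ?a" using p by (simp add: arc_points_def)
  then show "?a \<in> arcs P F" using f by (auto simp: arcs_def)
  have "finite (fst ` arc_points P ?a)" using P by (auto simp: arc_points_def)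
  moreover have "branch f (rank f p) (fst p) = snd p"
    unfolding rank_def using branch_rank(2) card_fiber[OF f] p mem_zero_set by blast
  ultimately show "on_arc P ?a p"
    using mem by (auto simp: on_arc_def arc_lo_def arc_hi_def arc_height_def)
qed simp

lemma arc_system_arcs: "arc_system (arcs P F) (arc_lo P) (arc_hi P) arc_height (2 * b\<^sup>2)"
proof
  show "finite (arcs P F)" using card_arcs_le by simp
  show "continuous_on {arc_lo P a..arc_hi P a} (arc_height a)" if "a \<in> arcs P F" for a
    using that arc_branch(1) by (cases a) (auto simp: arc_height_def)
  fix a a' assume a: "a \<in> arcs P F" "a' \<in> arcs P F" "a \<noteq> a'"
  let ?X = "{x \<in> {arc_lo P a..arc_hi P a} \<inter> {arc_lo P a'..arc_hi P a'}. arc_height a x = arc_height a' x}"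
  let ?Y = "{x. \<exists>y. eval2 (fst a) x y = 0 \<and> eval2 (fst a') x y = 0}"
  have on: "on_arc P a (x, arc_height a x)" "on_arc P a' (x, arc_height a x)" if "x \<in> ?X" for x
    using that by (auto simp: on_arc_def)
  have "finite ?X \<and> card ?X \<le> 2 * b\<^sup>2"
  proof (cases "fst a = fst a'")
    case True
    then have "?X = {}" using on on_arc_unique[OF a(1,2)] a(3) by blast
    then show ?thesis by (simp only: finite.emptyI card.empty le0)
  next
    case False
    have F': "fst a \<in> F" "fst a' \<in> F" using a by (auto simp: arcs_def)
    then have Y: "finite ?Y \<and> card ?Y \<le> 2 * b\<^sup>2"
      using False primes nonvertical deg by (intro common_zeros_primes) auto
    have "?X \<subseteq> ?Y"
    proof
      fix x assume "x \<in> ?X"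
      from on[OF this] have "(x, arc_height a x) \<in> zero_set (fst a)" "(x, arc_height a x) \<in> zero_set (fst a')"
        using on_arcD(1)[of "fst a" "fst (snd a)" "snd (snd a)" "(x, arc_height a x)"]
          on_arcD(1)[of "fst a'" "fst (snd a')" "snd (snd a')" "(x, arc_height a x)"] a by simp_all
      then show "x \<in> ?Y" by (auto simp: zero_set_def)
    qed
    then show ?thesis using Y by (meson card_mono finite_subset le_trans)
  qed
  then show "finite ?X" "card ?X \<le> 2 * b\<^sup>2" by auto
qed

text \<open>
Through one point passes at most one arc of each curve.
\<close>

lemma card_arcs_through_le:
  assumes "T \<noteq> {}"
  shows "card {a \<in> arcs P F. \<forall>p\<in>T. on_arc P a p} \<le> card {f \<in> F. T \<subseteq> zero_set f}"
proof (rule card_inj_on_le)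
  show "inj_on fst {a \<in> arcs P F. \<forall>p\<in>T. on_arc P a p}"
    using assms on_arc_unique by (intro inj_onI) blast
  show "fst ` {a \<in> arcs P F. \<forall>p\<in>T. on_arc P a p} \<subseteq> {f \<in> F. T \<subseteq> zero_set f}"
  proof
    fix f assume "f \<in> fst ` {a \<in> arcs P F. \<forall>p\<in>T. on_arc P a p}"
    then obtain j i where a: "(f, j, i) \<in> arcs P F" "\<And>p. p \<in> T \<Longrightarrow> on_arc P (f, j, i) p" by auto
    then have "T \<subseteq> zero_set f" using on_arcD(1) by blast
    then show "f \<in> {f \<in> F. T \<subseteq> zero_set f}" using a(1) by (simp add: arcs_def)
  qed
qed (use F in simp)

text \<open>
The points over critical values are on no arc. A curve has boundedly many critical values with boundedly
many points over each, since it contains no vertical line.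
\<close>

lemma sum_incidences_le_arcs:
  "(\<Sum>f\<in>F. card (P \<inter> zero_set f)) \<le>
    card F * ((b + 2 * b\<^sup>2) * b) + (\<Sum>a\<in>arcs P F. card {p \<in> P. on_arc P a p})"
proof -
  have finA: "finite (arcs P F)" using card_arcs_le by simp
  have "card (P \<inter> zero_set f) \<le> (b + 2 * b\<^sup>2) * b + (\<Sum>a\<in>{a \<in> arcs P F. fst a = f}. card {p \<in> P. on_arc P a p})"
    if f: "f \<in> F" for f
  proof -
    let ?S = "Sigma (crit f) (fiber f)" and ?U = "\<Union>a\<in>{a \<in> arcs P F. fst a = f}. {p \<in> P. on_arc P a p}"
    have finS: "finite ?S" using finite_crit[OF f] card_fiber[OF f] by auto
    have "P \<inter> zero_set f \<subseteq> ?S \<union> ?U"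
    proof
      fix p assume p: "p \<in> P \<inter> zero_set f"
      show "p \<in> ?S \<union> ?U"
      proof (cases "fst p \<in> crit f")
        case True
        then have "(fst p, snd p) \<in> ?S" using p mem_zero_set by blast
        then show ?thesis by simp
      next
        case False
        then show ?thesis using p on_some_arc[OF f, of p] by blast
      qed
    qed
    then have "card (P \<inter> zero_set f) \<le> card (?S \<union> ?U)"
      using finS finA P by (intro card_mono) auto
    also have "\<dots> \<le> card ?S + card ?U" by (rule card_Un_le)
    also have "card ?S = (\<Sum>x\<in>crit f. card (fiber f x))"
      using finite_crit[OF f] card_fiber[OF f] by simp
    also have "\<dots> \<le> card (crit f) * b"
      using sum_bounded_above[of "crit f" "\<lambda>x. card (fiber f x)" b] card_fiber[OF f] by simp
    also have "\<dots> \<le> (b + 2 * b\<^sup>2) * b" using finite_crit[OF f] by simp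
    also have "card ?U \<le> (\<Sum>a\<in>{a \<in> arcs P F. fst a = f}. card {p \<in> P. on_arc P a p})"
      using finA by (intro card_UN_le) auto
    finally show ?thesis by simp
  qed
  then have "(\<Sum>f\<in>F. card (P \<inter> zero_set f)) \<le>
    (\<Sum>f\<in>F. (b + 2 * b\<^sup>2) * b + (\<Sum>a\<in>{a \<in> arcs P F. fst a = f}. card {p \<in> P. on_arc P a p}))"
    by (rule sum_mono)
  also have "\<dots> = card F * ((b + 2 * b\<^sup>2) * b) + (\<Sum>f\<in>F. \<Sum>a\<in>{a \<in> arcs P F. fst a = f}. card {p \<in> P. on_arc P a p})"
    by (simp add: sum.distrib)
  also have "(\<Sum>f\<in>F. \<Sum>a\<in>{a \<in> arcs P F. fst a = f}. card {p \<in> P. on_arc P a p})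
      = (\<Sum>a\<in>arcs P F. card {p \<in> P. on_arc P a p})"
    using F finA by (intro sum.group) (auto simp: arcs_def)
  finally show ?thesis .
qed

text \<open>
The bound for arcs, with the number of arcs replaced by a constant multiple of the number of curves.
\<close>

lemma sum_incidences_nonvertical_le:
  assumes k: "0 < k" and P0: "P \<noteq> {}"
    and few: "\<And>T. T \<subseteq> P \<Longrightarrow> card T = k \<Longrightarrow> card {f \<in> F. T \<subseteq> zero_set f} \<le> C"
  defines "m \<equiv> real (card P)" and "n \<equiv> real (card F)"
    and "K \<equiv> real (2 * b\<^sup>2) + real k * (9 + 6 * real (2 * b\<^sup>2)) + 20 * real k * (1 + real C)"
    and "L \<equiv> 1 + real ((b + 2 * b\<^sup>2 + 1) * b)"
  shows "(\<Sum>f\<in>F. real (card (P \<inter> zero_set f))) \<le>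
    (1 + K) * L * (m powr (k / (2 * real k - 1)) * n powr ((2 * real k - 2) / (2 * real k - 1)) + m + n)"
proof -
  let ?A = "arcs P F"
  interpret arc_system ?A "arc_lo P" "arc_hi P" arc_height "2 * b\<^sup>2" by (rule arc_system_arcs)
  have passes: "passes = on_arc P"
    by (intro ext) (simp add: passes_def over_def on_arc_def conj_assoc)
  define N where "N = real (card ?A)"
  define e where "e = (2 * real k - 2) / (2 * real k - 1)"
  define M where "M = m powr (k / (2 * real k - 1))"
  have e: "0 \<le> e" "e \<le> 1" using k by (auto simp: e_def divide_simps)
  have nonneg: "0 \<le> M" "0 \<le> m" "0 \<le> n" "0 \<le> K" "1 \<le> L" "0 \<le> N"
    by (simp_all add: M_def m_def n_def K_def L_def N_def)
  have NL: "N \<le> L * n"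
  proof -
    have "N \<le> real (card F * ((b + 2 * b\<^sup>2 + 1) * b))"
      unfolding N_def using card_arcs_le by (intro of_nat_mono) simp
    also have "\<dots> \<le> L * n" by (simp add: L_def n_def algebra_simps)
    finally show ?thesis .
  qed
  have arcsum: "(\<Sum>a\<in>?A. real (card {p \<in> P. on_arc P a p})) \<le> K * (M * N powr e + m + N)"
  proof (cases "?A = {}")
    case False
    have "card {a \<in> ?A. \<forall>p\<in>T. passes a p} \<le> C" if "T \<subseteq> P" "card T = k" for T
    proof -
      have "T \<noteq> {}" using that k by auto
      then show ?thesis using card_arcs_through_le[of T] few[OF that] unfolding passes by linarith
    qed
    then show ?thesis
      using incidences_bound[OF P P0 k False, of C]
      unfolding passes K_def M_def N_def m_def e_def by simp
  qed (use nonneg in simp)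
  have "N powr e \<le> (L * n) powr e" using NL e nonneg by (intro powr_mono2) auto
  also have "\<dots> = L powr e * n powr e" using nonneg by (simp add: powr_mult)
  also have "\<dots> \<le> L powr 1 * n powr e" using nonneg e by (intro mult_right_mono powr_mono) auto
  finally have Ne: "N powr e \<le> L * n powr e" using nonneg by simp
  have "M * N powr e + m + N \<le> M * (L * n powr e) + L * m + L * n"
    using Ne NL nonneg mult_right_mono[of 1 L m] by (intro add_mono mult_left_mono) auto
  also have "\<dots> = L * (M * n powr e + m + n)" by (simp add: algebra_simps)
  finally have 1: "(\<Sum>a\<in>?A. real (card {p \<in> P. on_arc P a p})) \<le> K * (L * (M * n powr e + m + n))"
    using arcsum nonneg by (meson mult_left_mono order_trans)
  have 2: "real (card F * ((b + 2 * b\<^sup>2) * b)) \<le> L * (M * n powr e + m + n)"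
  proof -
    have "real (card F * ((b + 2 * b\<^sup>2) * b)) \<le> L * n" by (simp add: L_def n_def algebra_simps)
    also have "\<dots> \<le> L * (M * n powr e + m + n)" using nonneg by (intro mult_left_mono) auto
    finally show ?thesis .
  qed
  have "(\<Sum>f\<in>F. real (card (P \<inter> zero_set f))) \<le>
      real (card F * ((b + 2 * b\<^sup>2) * b)) + (\<Sum>a\<in>?A. real (card {p \<in> P. on_arc P a p}))"
    using of_nat_mono[OF sum_incidences_le_arcs, where 'a = real] by (simp only: of_nat_sum of_nat_add)
  also have "\<dots> \<le> L * (M * n powr e + m + n) + K * (L * (M * n powr e + m + n))"
    by (rule add_mono[OF 2 1])
  finally show ?thesis unfolding M_def e_def by (simp add: algebra_simps)
qed

end

section \<open>The incidence bound for algebraic curves\<close>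

text \<open>
A vertical prime with a zero over \<open>x\<close> is, up to a unit, the equation of the vertical line at \<open>x\<close>.
\<close>

lemma card_vertical_through_le_1:
  assumes "finite F" "\<And>f. f \<in> F \<Longrightarrow> prime f \<and> degree f = 0"
  shows "card {f \<in> F. p \<in> zero_set f} \<le> 1"
proof -
  have "{f \<in> F. p \<in> zero_set f} \<subseteq> {normalize [:[:- fst p, 1:]:]}"
    using assms(2) vertical_prime[of _ "fst p" "snd p"] by (auto simp: mem_zero_set fiber_def)
  from card_mono[OF _ this] show ?thesis by simp
qed

lemma sum_incidences_vertical_le:
  assumes P: "finite P" and F: "finite F" "\<And>f. f \<in> F \<Longrightarrow> prime f \<and> degree f = 0"
  shows "(\<Sum>f\<in>F. card (P \<inter> zero_set f)) \<le> card P"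
proof -
  have "(\<Sum>f\<in>F. card (P \<inter> zero_set f)) = (\<Sum>f\<in>F. card {p \<in> P. p \<in> zero_set f})"
    by (simp only: Int_def)
  also have "\<dots> = (\<Sum>p\<in>P. card {f \<in> F. p \<in> zero_set f})"
    by (rule sum_multicount_gen) (use P F in auto)
  also have "\<dots> \<le> (\<Sum>p\<in>P. 1)" by (intro sum_mono card_vertical_through_le_1 F)
  finally show ?thesis by simp
qed

lemma incidences_eq_sum:
  assumes "finite P" "finite \<Gamma>"
  shows "incidences P \<Gamma> = (\<Sum>\<gamma>\<in>\<Gamma>. card (P \<inter> \<gamma>))"
proof -
  have "{(p, \<gamma>). p \<in> P \<and> \<gamma> \<in> \<Gamma> \<and> p \<in> \<gamma>} = prod.swap ` Sigma \<Gamma> (\<lambda>\<gamma>. P \<inter> \<gamma>)"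
    by force
  then have "incidences P \<Gamma> = card (Sigma \<Gamma> (\<lambda>\<gamma>. P \<inter> \<gamma>))"
    unfolding incidences_def by (simp add: card_image)
  then show ?thesis using assms by simp
qed

text \<open>
A prime component with at least \<open>k\<close> of the points on it contains a \<open>k\<close>-subset of them, which by
assumption lies on at most \<open>C\<close> of the curves. The other components contribute less than \<open>k\<close> each, and a curve
has at most \<open>b\<close> components.
\<close>

lemma sum_curves_le_sum_primes:
  fixes g :: "(real \<times> real) set \<Rightarrow> real poly poly"
  assumes fin: "finite P" "finite \<Gamma>"
    and g: "\<And>\<gamma>. \<gamma> \<in> \<Gamma> \<Longrightarrow> g \<gamma> \<noteq> 0 \<and> total_degree (g \<gamma>) \<le> b \<and> \<gamma> = zero_set (g \<gamma>)"
    and few: "\<And>S. finite S \<Longrightarrow> card S = k \<Longrightarrow> card {\<gamma>\<in>\<Gamma>. S \<subseteq> \<gamma>} \<le> C"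
  shows "(\<Sum>\<gamma>\<in>\<Gamma>. card (P \<inter> \<gamma>)) \<le>
    card \<Gamma> * (b * k) + C * (\<Sum>f\<in>(\<Union>\<gamma>\<in>\<Gamma>. prime_factors (g \<gamma>)). card (P \<inter> zero_set f))"
proof -
  let ?F = "\<Union>\<gamma>\<in>\<Gamma>. prime_factors (g \<gamma>)" and ?w = "\<lambda>f. card (P \<inter> zero_set f)"
  let ?big = "\<lambda>f. k \<le> ?w f"
  have sub: "zero_set f \<subseteq> \<gamma>" if "\<gamma> \<in> \<Gamma>" "f \<in> prime_factors (g \<gamma>)" for f \<gamma>
    using g[OF that(1)] that(2) zero_set_dvd factorsD(2) by blast
  have one: "card (P \<inter> \<gamma>) \<le> b * k + (\<Sum>f\<in>{f \<in> prime_factors (g \<gamma>). ?big f}. ?w f)" if \<gamma>: "\<gamma> \<in> \<Gamma>" for \<gamma>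
  proof -
    have cf: "card (prime_factors (g \<gamma>)) \<le> b"
      using g[OF \<gamma>] card_factors_le[of "g \<gamma>"] by auto
    have "P \<inter> \<gamma> \<subseteq> (\<Union>f\<in>prime_factors (g \<gamma>). P \<inter> zero_set f)"
      using g[OF \<gamma>] zero_set_factors[of "g \<gamma>"] by auto
    then have "card (P \<inter> \<gamma>) \<le> card (\<Union>f\<in>prime_factors (g \<gamma>). P \<inter> zero_set f)"
      using fin finite_set_mset by (intro card_mono) auto
    also have "\<dots> \<le> (\<Sum>f\<in>prime_factors (g \<gamma>). ?w f)" by (rule card_UN_le[OF finite_set_mset])
    also have "\<dots> \<le> (\<Sum>f\<in>prime_factors (g \<gamma>). k + (if ?big f then ?w f else 0))"
      by (intro sum_mono) auto
    also have "\<dots> = card (prime_factors (g \<gamma>)) * k + (\<Sum>f\<in>{f \<in> prime_factors (g \<gamma>). ?big f}. ?w f)"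
      using finite_set_mset by (simp add: sum.distrib sum.inter_filter)
    also have "\<dots> \<le> b * k + (\<Sum>f\<in>{f \<in> prime_factors (g \<gamma>). ?big f}. ?w f)"
      using cf by (intro add_right_mono mult_right_mono) auto
    finally show ?thesis .
  qed
  have finF: "finite ?F" using fin finite_set_mset by blast
  have mult: "card {\<gamma> \<in> \<Gamma>. f \<in> prime_factors (g \<gamma>)} \<le> C" if "?big f" for f
  proof -
    obtain S where S: "S \<subseteq> P \<inter> zero_set f" "card S = k" "finite S"
      using obtain_subset_with_card_n[OF \<open>?big f\<close>] by metis
    have "card {\<gamma> \<in> \<Gamma>. f \<in> prime_factors (g \<gamma>)} \<le> card {\<gamma> \<in> \<Gamma>. S \<subseteq> \<gamma>}"
    proof (rule card_mono)
      show "{\<gamma> \<in> \<Gamma>. f \<in> prime_factors (g \<gamma>)} \<subseteq> {\<gamma> \<in> \<Gamma>. S \<subseteq> \<gamma>}"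
        using sub S(1) by blast
    qed (use fin in simp)
    also have "\<dots> \<le> C" by (rule few[OF S(3,2)])
    finally show ?thesis .
  qed
  have "(\<Sum>\<gamma>\<in>\<Gamma>. card (P \<inter> \<gamma>)) \<le> (\<Sum>\<gamma>\<in>\<Gamma>. b * k + (\<Sum>f\<in>{f \<in> prime_factors (g \<gamma>). ?big f}. ?w f))"
    by (intro sum_mono one)
  also have "\<dots> = card \<Gamma> * (b * k) + (\<Sum>\<gamma>\<in>\<Gamma>. \<Sum>f\<in>{f \<in> {f \<in> ?F. ?big f}. f \<in> prime_factors (g \<gamma>)}. ?w f)"
    unfolding sum.distrib by (intro arg_cong2[where f = "(+)"] sum.cong) auto
  also have "(\<Sum>\<gamma>\<in>\<Gamma>. \<Sum>f\<in>{f \<in> {f \<in> ?F. ?big f}. f \<in> prime_factors (g \<gamma>)}. ?w f)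
      = (\<Sum>f\<in>{f \<in> ?F. ?big f}. \<Sum>\<gamma>\<in>{\<gamma> \<in> \<Gamma>. f \<in> prime_factors (g \<gamma>)}. ?w f)"
    by (rule sum.swap_restrict) (use fin finF in auto)
  also have "\<dots> \<le> (\<Sum>f\<in>{f \<in> ?F. ?big f}. C * ?w f)"
    using mult by (intro sum_mono) simp
  also have "\<dots> \<le> (\<Sum>f\<in>?F. C * ?w f)"
    using finF by (intro sum_mono2) auto
  finally show ?thesis by (simp add: sum_distrib_left)
qed

text \<open>
Vertical components contribute at most one incidence per point. For the others the bound for
arcs applies, with \<open>b C\<close> in place of \<open>C\<close>: each component through \<open>k\<close> given points lies on one of at most \<open>C\<close>
curves through them, and a curve has at most \<open>b\<close> components.
\<close>

lemma incidences_curves_bound: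
  fixes b k C :: nat and P :: "(real \<times> real) set" and \<Gamma> :: "(real \<times> real) set set"
  assumes k: "0 < k" and P: "finite P" "P \<noteq> {}" and \<Gamma>: "finite \<Gamma>"
    and alg: "\<And>\<gamma>. \<gamma> \<in> \<Gamma> \<Longrightarrow> algebraic_curve b \<gamma>"
    and few: "\<And>S. finite S \<Longrightarrow> card S = k \<Longrightarrow> card {\<gamma>\<in>\<Gamma>. S \<subseteq> \<gamma>} \<le> C"
  defines "m \<equiv> real (card P)" and "n \<equiv> real (card \<Gamma>)"
    and "K \<equiv> (1 + (real (2 * b\<^sup>2) + real k * (9 + 6 * real (2 * b\<^sup>2)) + 20 * real k * (1 + real (b * C))))
           * (1 + real ((b + 2 * b\<^sup>2 + 1) * b))"
  shows "real (incidences P \<Gamma>) \<le> (real (b * k) + real C * (1 + K * (1 + real b))) *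
    (m powr (real k / (2 * real k - 1)) * n powr ((2 * real k - 2) / (2 * real k - 1)) + m + n)"
proof -
  have "\<exists>h. h \<noteq> 0 \<and> total_degree h \<le> b \<and> \<gamma> = zero_set h" if "\<gamma> \<in> \<Gamma>" for \<gamma>
    using alg[OF that] unfolding algebraic_curve_def by (metis pCons_0_0)
  then obtain g where g: "\<And>\<gamma>. \<gamma> \<in> \<Gamma> \<Longrightarrow> g \<gamma> \<noteq> 0 \<and> total_degree (g \<gamma>) \<le> b \<and> \<gamma> = zero_set (g \<gamma>)"
    by metis
  define F where "F = (\<Union>\<gamma>\<in>\<Gamma>. prime_factors (g \<gamma>))"
  define V where "V = {f \<in> F. degree f = 0}"
  define W where "W = {f \<in> F. 0 < degree f}"
  let ?w = "\<lambda>f. card (P \<inter> zero_set f)"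
  have finF: "finite F" using \<Gamma> finite_set_mset by (auto simp: F_def)
  have Fprime: "prime f" if "f \<in> F" for f using that factorsD(1) by (auto simp: F_def)
  have Fdeg: "total_degree f \<le> b" if "f \<in> F" for f
  proof -
    obtain \<gamma> where \<gamma>: "\<gamma> \<in> \<Gamma>" "f \<in> prime_factors (g \<gamma>)" using \<open>f \<in> F\<close> by (auto simp: F_def)
    then show ?thesis using g[OF \<gamma>(1)] total_degree_dvd[OF factorsD(2)[OF \<gamma>(2)]] by (meson le_trans)
  qed
  have cf: "card (prime_factors (g \<gamma>)) \<le> b" if "\<gamma> \<in> \<Gamma>" for \<gamma>
    using g[OF that] card_factors_le[of "g \<gamma>"] by auto
  have cardW: "card W \<le> b * card \<Gamma>"
  proof -
    have "card W \<le> card F" using finF by (intro card_mono) (auto simp: W_def)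
    also have "\<dots> \<le> (\<Sum>\<gamma>\<in>\<Gamma>. card (prime_factors (g \<gamma>)))" unfolding F_def by (rule card_UN_le[OF \<Gamma>])
    also have "\<dots> \<le> (\<Sum>\<gamma>\<in>\<Gamma>. b)" by (intro sum_mono cf)
    finally show ?thesis by (simp add: mult.commute)
  qed
  have fewW: "card {f \<in> W. T \<subseteq> zero_set f} \<le> b * C" if T: "T \<subseteq> P" "card T = k" for T
  proof -
    have finT: "finite T" using T P finite_subset by blast
    let ?G = "{\<gamma> \<in> \<Gamma>. T \<subseteq> \<gamma>}"
    have "{f \<in> W. T \<subseteq> zero_set f} \<subseteq> (\<Union>\<gamma>\<in>?G. prime_factors (g \<gamma>))"
    proof
      fix f assume f: "f \<in> {f \<in> W. T \<subseteq> zero_set f}"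
      then obtain \<gamma> where \<gamma>: "\<gamma> \<in> \<Gamma>" "f \<in> prime_factors (g \<gamma>)" by (auto simp: W_def F_def)
      then have "zero_set f \<subseteq> \<gamma>" using g zero_set_dvd[OF factorsD(2)] by blast
      then show "f \<in> (\<Union>\<gamma>\<in>?G. prime_factors (g \<gamma>))" using \<gamma> f by blast
    qed
    then have "card {f \<in> W. T \<subseteq> zero_set f} \<le> card (\<Union>\<gamma>\<in>?G. prime_factors (g \<gamma>))"
      using \<Gamma> finite_set_mset by (intro card_mono) auto
    also have "\<dots> \<le> (\<Sum>\<gamma>\<in>?G. card (prime_factors (g \<gamma>)))" using \<Gamma> by (intro card_UN_le) auto
    also have "\<dots> \<le> (\<Sum>\<gamma>\<in>?G. b)" by (intro sum_mono cf) auto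
    also have "\<dots> \<le> b * C" using few[OF finT T(2)] by simp
    finally show ?thesis .
  qed
  define M where "M = m powr (real k / (2 * real k - 1))"
  define e where "e = (2 * real k - 2) / (2 * real k - 1)"
  define X where "X = M * n powr e + m + n"
  have e: "0 \<le> e" "e \<le> 1" using k by (auto simp: e_def divide_simps)
  have nonneg: "0 \<le> M" "0 \<le> m" "0 \<le> n" "0 \<le> K" by (simp_all add: M_def m_def n_def K_def)
  have "(\<Sum>f\<in>W. real (?w f)) \<le> K * (M * real (card W) powr e + m + real (card W))"
    unfolding K_def M_def e_def m_def
    using fewW P k finF Fprime Fdeg
    by (intro sum_incidences_nonvertical_le) (auto simp: W_def)
  also have "\<dots> \<le> K * ((1 + real b) * X)"
  proof (rule mult_left_mono[OF _ nonneg(4)])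
    have bn: "real (card W) \<le> (1 + real b) * n"
    proof -
      have "real (card W) \<le> real (b * card \<Gamma>)" using cardW by (rule of_nat_mono)
      also have "\<dots> \<le> (1 + real b) * n" by (simp add: n_def algebra_simps)
      finally show ?thesis .
    qed
    have "real (card W) powr e \<le> ((1 + real b) * n) powr e" using bn e by (intro powr_mono2) auto
    also have "\<dots> = (1 + real b) powr e * n powr e" using nonneg by (simp add: powr_mult)
    also have "\<dots> \<le> (1 + real b) powr 1 * n powr e" using e by (intro mult_right_mono powr_mono) auto
    finally have "real (card W) powr e \<le> (1 + real b) * n powr e" by simp
    then have "M * real (card W) powr e + m + real (card W) \<le> M * ((1 + real b) * n powr e) + (1 + real b) * m + (1 + real b) * n"
      using bn nonneg mult_right_mono[of 1 "1 + real b" m] by (intro add_mono mult_left_mono) auto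
    then show "M * real (card W) powr e + m + real (card W) \<le> (1 + real b) * X"
      by (simp add: X_def algebra_simps)
  qed
  finally have sumW: "(\<Sum>f\<in>W. real (?w f)) \<le> K * (1 + real b) * X" by (simp add: mult.assoc)
  have X: "m \<le> X" "n \<le> X" using nonneg by (auto simp: X_def)
  have sumV: "(\<Sum>f\<in>V. real (?w f)) \<le> m"
  proof -
    have "(\<Sum>f\<in>V. ?w f) \<le> card P"
      by (rule sum_incidences_vertical_le[OF P(1)]) (use finF Fprime in \<open>simp_all add: V_def\<close>)
    from of_nat_mono[OF this, where 'a = real] show ?thesis by (simp only: of_nat_sum m_def)
  qed
  have "(\<Sum>f\<in>F. real (?w f)) = (\<Sum>f\<in>V. real (?w f)) + (\<Sum>f\<in>W. real (?w f))"
  proof -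
    have U: "V \<union> W = F" and disj: "V \<inter> W = {}" by (auto simp: V_def W_def)
    have fin: "finite V" "finite W" using finF by (simp_all add: V_def W_def)
    from sum.union_disjoint[OF fin disj, of "\<lambda>f. real (?w f)"] show ?thesis unfolding U .
  qed
  also have "\<dots> \<le> (1 + K * (1 + real b)) * X"
    using sumV sumW X by (simp add: distrib_right)
  finally have sumF: "(\<Sum>f\<in>F. real (?w f)) \<le> (1 + K * (1 + real b)) * X" .
  have "real (incidences P \<Gamma>) \<le> real (card \<Gamma> * (b * k) + C * (\<Sum>f\<in>F. ?w f))"
    unfolding incidences_eq_sum[OF P(1) \<Gamma>] F_def
    by (intro of_nat_mono sum_curves_le_sum_primes P \<Gamma> g few)
  also have "\<dots> = real (b * k) * n + real C * (\<Sum>f\<in>F. real (?w f))"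
    by (simp add: n_def mult.commute)
  also have "\<dots> \<le> real (b * k) * X + real C * ((1 + K * (1 + real b)) * X)"
    using X sumF by (intro add_mono mult_left_mono) auto
  also have "\<dots> = (real (b * k) + real C * (1 + K * (1 + real b))) * X"
    by (simp add: distrib_right)
  finally show ?thesis unfolding X_def M_def e_def .
qed

theorem theorem4p1:
  fixes b k C :: nat
  assumes "b > 0" and "k > 0" and "C > 0"
  shows "\<exists>A::real. \<forall>m n :: nat. \<forall>P :: (real \<times> real) set. \<forall>\<Gamma> :: (real \<times> real) set set.
    m > 0 \<longrightarrow> n > 0 \<longrightarrow>
    finite P \<longrightarrow> card P = m \<longrightarrow>
    finite \<Gamma> \<longrightarrow> card \<Gamma> = n \<longrightarrow>
    (\<forall>\<gamma>\<in>\<Gamma>. algebraic_curve b \<gamma>) \<longrightarrow>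
    (\<forall>S :: (real \<times> real) set. finite S \<longrightarrow> card S = k \<longrightarrow> card {\<gamma>\<in>\<Gamma>. S \<subseteq> \<gamma>} \<le> C) \<longrightarrow>
    real (incidences P \<Gamma>) \<le>
      A * (real m powr (real k / (2 * real k - 1)) * real n powr ((2 * real k - 2) / (2 * real k - 1))
           + real m + real n)"
proof -
  let ?K = "(1 + (real (2 * b\<^sup>2) + real k * (9 + 6 * real (2 * b\<^sup>2)) + 20 * real k * (1 + real (b * C))))
           * (1 + real ((b + 2 * b\<^sup>2 + 1) * b))"
  show ?thesis
  proof (intro exI[of _ "real (b * k) + real C * (1 + ?K * (1 + real b))"] allI impI)
    fix m n :: nat and P :: "(real \<times> real) set" and \<Gamma> :: "(real \<times> real) set set"
    assume mn: "m > 0" "card P = m" "card \<Gamma> = n"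
      and fin: "finite P" "finite \<Gamma>" and alg: "\<forall>\<gamma>\<in>\<Gamma>. algebraic_curve b \<gamma>"
      and few: "\<forall>S :: (real \<times> real) set. finite S \<longrightarrow> card S = k \<longrightarrow> card {\<gamma>\<in>\<Gamma>. S \<subseteq> \<gamma>} \<le> C"
    have "P \<noteq> {}" using mn by auto
    from incidences_curves_bound[of k P \<Gamma> b C, OF assms(2) fin(1) this fin(2)] alg few
    show "real (incidences P \<Gamma>) \<le> (real (b * k) + real C * (1 + ?K * (1 + real b))) *
      (real m powr (real k / (2 * real k - 1)) * real n powr ((2 * real k - 2) / (2 * real k - 1))
           + real m + real n)"
      unfolding mn(2,3) by blast
  qed
qed

end
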